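(* Let $n\geq 2$ be an integer and let $p_1,\dots,p_n$ be distinct primes such that $p_j$ divides $p_i-1$ for all $2\leq j\leq n$ and all $1\leq i<j$. Let $A$ be the trivial brace $\mathbb{F}_{p_2}\times\dots\times\mathbb{F}_{p_n}$ and let $\overline{G}_n$, $\alpha'_n\colon A\to\operatorname{Aut}(\overline{G}_n,+,\cdot)$ and $b\colon\overline{G}_n\times\overline{G}_n\to A$ be the left brace, the action and the symmetric bilinear form constructed from these data (as described in the context). Then the left brace $\overline{G}_n\rtimes_{\circ}A$, the asymmetric product of $\overline{G}_n$ by $A$ via $b$ and $\alpha'_n$, is simple and the derived length of its multiplicative group is $n+1$.
   Context: A left brace is a set $B$ with two operations $+$ and $\cdot$ such that $(B,+)$ is an abelian group, $(B,\cdot)$ is a group and $a\cdot(b+c)+a=a\cdot b+a\cdot c$ for all $a,b,c\in B$. The neutral elements of $(B,+)$ and $(B,\cdot)$ coincide and are denoted by $0$. The lambda map is $\lambda_a(b)=a\cdot b-a$. An ideal of $B$ is a normal subgroup $N$ of $(B,\cdot)$ such that $\lambda_b(a)\in N$ for all $b\in B$, $a\in N$. A non-zero left brace is simple if $\{0\}$ and $B$ are its only ideals. A trivial brace is a left brace with $a\cdot b=a+b$ for all $a,b$; any abelian group is regarded as a trivial brace in this way. The semidirect product $T\rtimes S$ of left braces via a group homomorphism $\sigma\colon(S,\cdot)\to\operatorname{Aut}(T,+,\cdot)$ is $T\times S$ with componentwise addition and $(t_1,s_1)(t_2,s_2)=(t_1\cdot\sigma_{s_1}(t_2),s_1\cdot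 s_2)$. Construction of $\overline{G}_j$. Each field $\mathbb{F}_{p_i}$ of order $p_i$ is also viewed as a trivial brace. Put $\overline{G}_1=\mathbb{F}_{p_1}$. For $2\leq j\leq n$, let $H_j$ be the set of all functions $\overline{G}_{j-1}\to\mathbb{F}_{p_j}$ with pointwise addition, as a trivial brace; for $g\in\overline{G}_{j-1}$ and $h\in H_j$ let $g(h)\in H_j$ be $g(h)(x)=h(g^{-1}x)$ (product and inverse in the multiplicative group of $\overline{G}_{j-1}$). Let $G_j=H_j\rtimes\overline{G}_{j-1}$ be the semidirect product of left braces with respect to this action (the wreath product of $\mathbb{F}_{p_j}$ and $\overline{G}_{j-1}$). Let $I_j\subseteq H_j$ be the set of constant functions and $N_j=\{(f,0)\in G_j\mid f\in I_j\}$, which is an ideal of $G_j$. Put $\overline{G}_j=G_j/N_j$ and $\overline{H}_j=H_j/I_j$; thus $\overline{G}_j=\overline{H}_j\rtimes\overline{G}_{j-1}$, and elements of $\overline{G}_n$ are written $(\overline{h}_n,\overline{h}_{n-1},\dots,\overline{h}_2,z)$ with $\overline{h}_j\in\overline{H}_j$ the class of $h_j\in H_j$ and $z\in\mathbb{F}_{p_1}$. The action. Let $a=(1,\dots,1)$, a generator of the (additive) group $A=\mathbb{F}_{p_2}\times\dots\times\mathbb{F}_{p_n}$, which is cyclic of order $p_2\cdots p_n$. Fix $\gamma\in\mathbb{F}_{p_1}^*$ of order $p_2\cdots p_n$. For $i\in\mathbb{Z}$ put $\alpha'_1(ia)(z)=\gamma^i z$ for $z\in\mathbb{F}_{p_1}$,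 and for $2\leq j\leq n$ define recursively $\widehat{\alpha}_{j-1}(ia)\colon H_j\to H_j$ by $\widehat{\alpha}_{j-1}(ia)(h)(g)=h(\alpha'_{j-1}(ia)^{-1}(g))$ and $$\alpha'_j(ia)(\overline{h},g)=\bigl(\overline{\widehat{\alpha}_{j-1}(ia)(h)},\,\alpha'_{j-1}(ia)(g)\bigr),\qquad h\in H_j,\ g\in\overline{G}_{j-1}.$$ Then $\alpha'_j\colon A\to\operatorname{Aut}(\overline{G}_j,+,\cdot)$ is a group homomorphism. The bilinear form. For $f\in H_j$ put $\varepsilon_j(f)=\sum_{g\in\overline{G}_{j-1}}f(g)\in\mathbb{F}_{p_j}$, and for $f_1,f_2\in H_j$ put $b_j(f_1,f_2)=\varepsilon_j(f_1)\varepsilon_j(f_2)-\varepsilon_j(f_1\bullet f_2)$, where $f_1\bullet f_2$ is the pointwise product (all products in the field $\mathbb{F}_{p_j}$). Then $b_j(I_j,H_j)=0$, so $b_j$ induces a symmetric bilinear form $b'_j\colon\overline{H}_j\times\overline{H}_j\to\mathbb{F}_{p_j}$. Define $$b\bigl((\overline{h}_n,\dots,\overline{h}_2,z),(\overline{h'}_n,\dots,\overline{h'}_2,z')\bigr)=\bigl(b'_2(\overline{h}_2,\overline{h'}_2),\dots,b'_n(\overline{h}_n,\overline{h'}_n)\bigr)\in A.$$ The asymmetric product. $\overline{G}_n\rtimes_\circ A$ is the set $\overline{G}_n\times A$ with operations $$(g,c)+(g',c')=(g+g',\;c+c'+b(g,g')),\qquad (g,c)\cdot(g',c')=(g\cdot\alpha'_n(c)(g'),\;c+c'),$$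 which is a left brace. *)

theory Defs
  imports
    "HOL-Algebra.Generated_Groups"
    "HOL-Algebra.Multiplicative_Group"
    "HOL-Algebra.Product_Groups"
    "HOL-Algebra.QuotRing"
    "HOL-Number_Theory.Residues"
    "HOL-Library.Countable_Set"
    "HOL-Library.Extended_Nat"
begin

section \<open>Left braces\<close>

text \<open>
  A left brace is carried by the record type \<^typ>\<open>'a ring\<close>: \<^const>\<open>ring.add\<close> is the additive
  operation, and \<^const>\<open>monoid.mult\<close> with \<^const>\<open>one\<close> is the multiplicative group.  The brace law is not
  distributivity, so none of the ring locales applies; that \<open>\<zero> = \<one>\<close> follows from the axioms.
\<close>

locale left_brace = abelian_group B + group B for B (structure) +
  assumes brace_law:
    "\<lbrakk>a \<in> carrier B; b \<in> carrier B; c \<in> carrier B\<rbrakk>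
      \<Longrightarrow> a \<otimes> (b \<oplus> c) \<oplus> a = a \<otimes> b \<oplus> a \<otimes> c"

definition lambda_map :: "('a, 'm) ring_scheme \<Rightarrow> 'a \<Rightarrow> 'a \<Rightarrow> 'a" where
  "lambda_map B a b = a \<otimes>\<^bsub>B\<^esub> b \<ominus>\<^bsub>B\<^esub> a"

definition brace_ideal :: "'a set \<Rightarrow> ('a, 'm) ring_scheme \<Rightarrow> bool" where
  "brace_ideal N B \<longleftrightarrow> N \<lhd> B \<and> (\<forall>b\<in>carrier B. \<forall>a\<in>N. lambda_map B b a \<in> N)"

definition simple_left_brace :: "('a, 'm) ring_scheme \<Rightarrow> bool" where
  "simple_left_brace B \<longleftrightarrow>
     left_brace B \<and> carrier B \<noteq> {\<zero>\<^bsub>B\<^esub>} \<and>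
     (\<forall>N. brace_ideal N B \<longrightarrow> N = {\<zero>\<^bsub>B\<^esub>} \<or> N = carrier B)"

definition trivial_brace :: "'a monoid \<Rightarrow> 'a ring" where
  "trivial_brace M =
     \<lparr>carrier = carrier M,
      monoid.mult = monoid.mult M, one = one M,
      ring.zero = one M, ring.add = monoid.mult M\<rparr>"

definition semidirect_brace :: "'a ring \<Rightarrow> 'b ring \<Rightarrow> ('b \<Rightarrow> 'a \<Rightarrow> 'a) \<Rightarrow> ('a \<times> 'b) ring" where
  "semidirect_brace T S \<sigma> =
     \<lparr>carrier = carrier T \<times> carrier S,
      monoid.mult = (\<lambda>(t1, s1) (t2, s2). (t1 \<otimes>\<^bsub>T\<^esub> \<sigma> s1 t2, s1 \<otimes>\<^bsub>S\<^esub> s2)),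
      one = (\<one>\<^bsub>T\<^esub>, \<one>\<^bsub>S\<^esub>),
      ring.zero = (\<zero>\<^bsub>T\<^esub>, \<zero>\<^bsub>S\<^esub>),
      ring.add = (\<lambda>(t1, s1) (t2, s2). (t1 \<oplus>\<^bsub>T\<^esub> t2, s1 \<oplus>\<^bsub>S\<^esub> s2))\<rparr>"

definition asymmetric_product ::
    "'a ring \<Rightarrow> 'b ring \<Rightarrow> ('a \<Rightarrow> 'a \<Rightarrow> 'b) \<Rightarrow> ('b \<Rightarrow> 'a \<Rightarrow> 'a) \<Rightarrow> ('a \<times> 'b) ring" where
  "asymmetric_product G A b \<alpha> =
     \<lparr>carrier = carrier G \<times> carrier A,
      monoid.mult = (\<lambda>(g, c) (g', c'). (g \<otimes>\<^bsub>G\<^esub> \<alpha> c g', c \<oplus>\<^bsub>A\<^esub> c')),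
      one = (\<one>\<^bsub>G\<^esub>, \<zero>\<^bsub>A\<^esub>),
      ring.zero = (\<zero>\<^bsub>G\<^esub>, \<zero>\<^bsub>A\<^esub>),
      ring.add = (\<lambda>(g, c) (g', c'). (g \<oplus>\<^bsub>G\<^esub> g', c \<oplus>\<^bsub>A\<^esub> c' \<oplus>\<^bsub>A\<^esub> b g g'))\<rparr>"

text \<open>The value is \<^term>\<open>\<infinity>\<close> exactly when the derived series never reaches the trivial subgroup.\<close>

definition derived_length :: "('a, 'm) monoid_scheme \<Rightarrow> enat" where
  "derived_length G = (INF d\<in>{d. (derived G ^^ d) (carrier G) = {\<one>\<^bsub>G\<^esub>}}. enat d)"


section \<open>The wreath product modulo constant functions\<close>

text \<open>
  Throughout, \<open>G\<close> is a left brace and \<open>F\<close> is a prime field, given as a ring.  Functions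
  \<open>G \<rightarrow> F\<close> are extensional on \<^term>\<open>carrier G\<close>.
\<close>

definition fun_brace :: "'a ring \<Rightarrow> 'b ring \<Rightarrow> ('a \<Rightarrow> 'b) ring" where
  "fun_brace G F = trivial_brace (product_group (carrier G) (\<lambda>_. add_monoid F))"

definition translate :: "'a ring \<Rightarrow> 'a \<Rightarrow> ('a \<Rightarrow> 'b) \<Rightarrow> ('a \<Rightarrow> 'b)" where
  "translate G g h = (\<lambda>x\<in>carrier G. h (inv\<^bsub>G\<^esub> g \<otimes>\<^bsub>G\<^esub> x))"

definition wreath_brace :: "'a ring \<Rightarrow> 'b ring \<Rightarrow> (('a \<Rightarrow> 'b) \<times> 'a) ring" where
  "wreath_brace G F = semidirect_brace (fun_brace G F) G (translate G)"

definition const_funs :: "'a ring \<Rightarrow> 'b ring \<Rightarrow> ('a \<Rightarrow> 'b) set" where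
  "const_funs G F = {\<lambda>x\<in>carrier G. c |c. c \<in> carrier F}"

definition const_ideal :: "'a ring \<Rightarrow> 'b ring \<Rightarrow> (('a \<Rightarrow> 'b) \<times> 'a) set" where
  "const_ideal G F = {(f, \<zero>\<^bsub>G\<^esub>) |f. f \<in> const_funs G F}"

text \<open>
  For an ideal \<open>N\<close> of a left brace \<open>B\<close> the additive and the multiplicative cosets of \<open>N\<close> coincide
  and both operations of \<open>B\<close> pass to them, so the formulas behind \<^term>\<open>B Quot N\<close>
  define the quotient left brace \<open>B / N\<close>.

  The coset of \<open>(h, g)\<close> modulo \<^const>\<open>const_ideal\<close> is the product set \<open>H \<times> {g}\<close>, where \<open>H\<close> is
  the coset of \<open>h\<close> modulo \<^const>\<open>const_funs\<close>.  Hence \<open>fun_class\<close> and \<open>base_elem\<close> below read off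
  the two components of an element under the identification of the quotient with the semidirect
  product of \<open>fun_brace G F Quot const_funs G F\<close> and \<open>G\<close>.
\<close>

definition wreath_quot :: "'a ring \<Rightarrow> 'b ring \<Rightarrow> (('a \<Rightarrow> 'b) \<times> 'a) set ring" where
  "wreath_quot G F = wreath_brace G F Quot const_ideal G F"

definition fun_class :: "(('a \<Rightarrow> 'b) \<times> 'a) set \<Rightarrow> ('a \<Rightarrow> 'b) set" where
  "fun_class C = fst ` C"

definition base_elem :: "(('a \<Rightarrow> 'b) \<times> 'a) set \<Rightarrow> 'a" where
  "base_elem C = the_elem (snd ` C)"

definition hat_map :: "'a ring \<Rightarrow> ('a \<Rightarrow> 'a) \<Rightarrow> ('a \<Rightarrow> 'b) \<Rightarrow> ('a \<Rightarrow> 'b)" where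
  "hat_map G \<phi> h = (\<lambda>g\<in>carrier G. h (inv_into (carrier G) \<phi> g))"

definition wreath_quot_map ::
    "'a ring \<Rightarrow> ('a \<Rightarrow> 'a) \<Rightarrow> (('a \<Rightarrow> 'b) \<times> 'a) set \<Rightarrow> (('a \<Rightarrow> 'b) \<times> 'a) set" where
  "wreath_quot_map G \<phi> C = (hat_map G \<phi> ` fun_class C) \<times> {\<phi> (base_elem C)}"

definition aug :: "'a ring \<Rightarrow> 'b ring \<Rightarrow> ('a \<Rightarrow> 'b) \<Rightarrow> 'b" where
  "aug G F f = (\<Oplus>\<^bsub>F\<^esub>g\<in>carrier G. f g)"

definition bform :: "'a ring \<Rightarrow> 'b ring \<Rightarrow> ('a \<Rightarrow> 'b) \<Rightarrow> ('a \<Rightarrow> 'b) \<Rightarrow> 'b" where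
  "bform G F f1 f2 =
     aug G F f1 \<otimes>\<^bsub>F\<^esub> aug G F f2 \<ominus>\<^bsub>F\<^esub> aug G F (\<lambda>g\<in>carrier G. f1 g \<otimes>\<^bsub>F\<^esub> f2 g)"

text \<open>The form induced on cosets, evaluated at arbitrary representatives.\<close>

definition bform_quot :: "'a ring \<Rightarrow> 'b ring \<Rightarrow> ('a \<Rightarrow> 'b) set \<Rightarrow> ('a \<Rightarrow> 'b) set \<Rightarrow> 'b" where
  "bform_quot G F H1 H2 = bform G F (SOME f. f \<in> H1) (SOME f. f \<in> H2)"


section \<open>The tower\<close>

text \<open>
  The step from \<open>G\<close> to \<^term>\<open>wreath_quot G F\<close> changes the type of the elements, so a tower of
  variable height does not fit in a single type.  After each step the (finite) carrier is therefore
  renamed injectively into \<^typ>\<open>int\<close>, the type of the elements of the first level, and the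
  operations are transported along the renaming.  Thus \<^term>\<open>relabel B\<close> is an isomorphic copy of
  \<open>B\<close> whenever the carrier of \<open>B\<close> is countable.
\<close>

definition enc :: "'a set \<Rightarrow> 'a \<Rightarrow> int" where
  "enc C x = int (to_nat_on C x)"

definition dec :: "'a set \<Rightarrow> int \<Rightarrow> 'a" where
  "dec C = inv_into C (enc C)"

lemma inj_on_enc: "countable C \<Longrightarrow> inj_on (enc C) C"
  by (auto simp: enc_def inj_on_def)

lemma dec_enc: "countable C \<Longrightarrow> x \<in> C \<Longrightarrow> dec C (enc C x) = x"
  by (simp add: dec_def inj_on_enc)

definition relabel :: "'a ring \<Rightarrow> int ring" where
  "relabel B =
     \<lparr>carrier = enc (carrier B) ` carrier B,
      monoid.mult = (\<lambda>x y. enc (carrier B) (dec (carrier B) x \<otimes>\<^bsub>B\<^esub> dec (carrier B) y)),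
      one = enc (carrier B) \<one>\<^bsub>B\<^esub>,
      ring.zero = enc (carrier B) \<zero>\<^bsub>B\<^esub>,
      ring.add = (\<lambda>x y. enc (carrier B) (dec (carrier B) x \<oplus>\<^bsub>B\<^esub> dec (carrier B) y))\<rparr>"

definition Fp :: "nat \<Rightarrow> int ring" where
  "Fp q = residue_ring (int q)"

text \<open>
  The index of a level is the one used for the primes: \<open>Gbar p j\<close> is built from \<open>p 1, \<dots>, p j\<close>.
  No value is specified for \<open>j = 0\<close>.
\<close>

fun Gbar :: "(nat \<Rightarrow> nat) \<Rightarrow> nat \<Rightarrow> int ring" where
  "Gbar p (Suc 0) = trivial_brace (add_monoid (Fp (p 1)))"
| "Gbar p (Suc (Suc k)) = relabel (wreath_quot (Gbar p (Suc k)) (Fp (p (Suc (Suc k)))))"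

definition level :: "(nat \<Rightarrow> nat) \<Rightarrow> nat \<Rightarrow> ((int \<Rightarrow> int) \<times> int) set set" where
  "level p j = carrier (wreath_quot (Gbar p (j - 1)) (Fp (p j)))"

text \<open>\<open>act p \<gamma> j i\<close> is the automorphism of \<open>Gbar p j\<close> assigned to the multiple \<open>i a\<close> of \<open>a\<close>.\<close>

fun act :: "(nat \<Rightarrow> nat) \<Rightarrow> int \<Rightarrow> nat \<Rightarrow> int \<Rightarrow> int \<Rightarrow> int" where
  "act p \<gamma> (Suc 0) i z = (\<gamma> [^]\<^bsub>mult_of (Fp (p 1))\<^esub> i) \<otimes>\<^bsub>Fp (p 1)\<^esub> z"
| "act p \<gamma> (Suc (Suc k)) i x =
     enc (level p (Suc (Suc k)))
       (wreath_quot_map (Gbar p (Suc k)) (act p \<gamma> (Suc k) i) (dec (level p (Suc (Suc k))) x))"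

definition Abrace :: "(nat \<Rightarrow> nat) \<Rightarrow> nat \<Rightarrow> (nat \<Rightarrow> int) ring" where
  "Abrace p n = trivial_brace (product_group {2..n} (\<lambda>j. add_monoid (Fp (p j))))"

definition Agen :: "nat \<Rightarrow> nat \<Rightarrow> int" where
  "Agen n = (\<lambda>j\<in>{2..n}. 1)"

definition actA :: "(nat \<Rightarrow> nat) \<Rightarrow> int \<Rightarrow> nat \<Rightarrow> (nat \<Rightarrow> int) \<Rightarrow> int \<Rightarrow> int" where
  "actA p \<gamma> n c = act p \<gamma> n (SOME i::int. [i] \<cdot>\<^bsub>Abrace p n\<^esub> Agen n = c)"

text \<open>
  \<open>hcoord p m j x\<close> is the component with index \<open>j\<close>, for \<open>2 \<le> j \<le> m\<close>, of an element
  \<open>x\<close> of \<open>Gbar p m\<close>.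
\<close>

fun hcoord :: "(nat \<Rightarrow> nat) \<Rightarrow> nat \<Rightarrow> nat \<Rightarrow> int \<Rightarrow> (int \<Rightarrow> int) set" where
  "hcoord p 0 j x = {}"
| "hcoord p (Suc m) j x =
     (if j = Suc m then fun_class (dec (level p (Suc m)) x)
      else hcoord p m j (base_elem (dec (level p (Suc m)) x)))"

definition bil :: "(nat \<Rightarrow> nat) \<Rightarrow> nat \<Rightarrow> int \<Rightarrow> int \<Rightarrow> (nat \<Rightarrow> int)" where
  "bil p n x y =
     (\<lambda>j\<in>{2..n}. bform_quot (Gbar p (j - 1)) (Fp (p j)) (hcoord p n j x) (hcoord p n j y))"

definition GbarA :: "(nat \<Rightarrow> nat) \<Rightarrow> int \<Rightarrow> nat \<Rightarrow> (int \<times> (nat \<Rightarrow> int)) ring" where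
  "GbarA p \<gamma> n = asymmetric_product (Gbar p n) (Abrace p n) (bil p n) (actA p \<gamma> n)"

end

theory Submission
  imports Defs
begin

text \<open>
  Write \<open>G\<close> for a level of the tower, \<open>q\<close> for the next prime and \<open>Q\<close> for the next level, so that
  \<open>Q = H \<rtimes> G\<close> where \<open>H\<close> consists of the functions from \<open>G\<close> to the field with \<open>q\<close> elements, modulo
  constants.  Everything rests on the congruence \<open>|G| \<equiv> 1\<close> modulo \<open>q\<close>, which the divisibility
  condition on the primes propagates because \<open>|Q| = q^(|G| - 1) |G|\<close>.  It has three consequences.

  \<^item> The form \<open>\<epsilon>(f) \<epsilon>(f') - \<epsilon>(f f')\<close> does not change when constants are added (\<open>fun_form_shift\<close>).
    Pairing with the indicator function of \<open>y\<close> gives \<open>\<epsilon>(f) - f(y)\<close>, so the form is nondegenerate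
    on \<open>H\<close> (\<open>fun_form_nondegenerate\<close>).

  \<^item> The sum of \<open>f - g f\<close> over all \<open>g\<close> in \<open>G\<close> is \<open>|G| f - \<epsilon>(f)\<close>, which is \<open>f\<close> modulo constants, so
    \<open>H\<close> is generated by commutators with \<open>G\<close>.  Hence a normal subgroup of \<open>Q\<close> that contains \<open>G\<close> is
    all of \<open>Q\<close>.  On the first level an element \<open>c \<noteq> 0\<close> of \<open>A\<close> acts as multiplication by a power of
    \<open>\<gamma>\<close> other than \<open>1\<close>, so the displacements \<open>z - c z\<close> exhaust that level.  Climbing the tower,
    a normal subgroup of any level that contains all displacements \<open>x (c x)\<^sup>-\<^sup>1\<close> is the
    whole level (\<open>normal_displacements_imp_all\<close>).

  \<^item> The order of \<open>k \<in> G\<close> is prime to \<open>q\<close>, so the image of \<open>k - 1\<close> on \<open>H\<close> equals that of \<open>(k - 1)\<^sup>2\<close>.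
    Therefore \<open>h - k h\<close> lies in the derived subgroup number \<open>d + 1\<close> of \<open>Q\<close> whenever \<open>k\<close> lies in number \<open>d\<close>
    of \<open>G\<close> (\<open>derived_displacement\<close>), and it is nonzero for a suitable \<open>h\<close> if \<open>k \<noteq> 1\<close>.  As \<open>H\<close> is abelian,
    each step of the tower raises the derived length by exactly one.

  Simplicity of the asymmetric product: let \<open>N\<close> be a nonzero ideal.  Since \<open>(g, c) \<noteq> 0\<close> either lies in
  the top \<open>H\<close> already or permutes the points of the level below nontrivially, conjugation yields an
  element \<open>(u, d)\<close> of \<open>N\<close> with \<open>u\<close> nonzero in the top \<open>H\<close> (\<open>nonzero_element_meets_form\<close>).  Elements \<open>x\<close> of
  that \<open>H\<close> have \<open>\<lambda>\<^sub>x(u) = u\<close>, and then \<open>\<lambda>\<close> changes only the second component, by \<open>b(u, x)\<close>; so \<open>N\<close> contains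
  some \<open>(0, c)\<close> with \<open>c \<noteq> 0\<close>.  Commutators with \<open>(0, c)\<close> are displacements, so \<open>N\<close> contains the whole first
  factor, then all values of \<open>b\<close>, and one of these values generates the cyclic group \<open>A\<close>.

  Derived length: the same argument shows that the derived subgroup of the asymmetric product is its
  first factor, whose derived length is \<open>n\<close>.
\<close>

section \<open>Left braces\<close>

lemma commutator_in_derived:
  assumes "a \<in> H" "b \<in> H"
  shows "a \<otimes>\<^bsub>G\<^esub> b \<otimes>\<^bsub>G\<^esub> inv\<^bsub>G\<^esub> a \<otimes>\<^bsub>G\<^esub> inv\<^bsub>G\<^esub> b \<in> derived G H"
  using assms unfolding derived_def by (intro generate.incl) blast

context left_brace begin

lemma zero_eq_one: "\<zero>\<^bsub>B\<^esub> = \<one>\<^bsub>B\<^esub>"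
  using brace_law[of "\<one>\<^bsub>B\<^esub>" "\<zero>\<^bsub>B\<^esub>" "\<zero>\<^bsub>B\<^esub>"] by simp

lemma lambda_closed [simp, intro]:
  "a \<in> carrier B \<Longrightarrow> b \<in> carrier B \<Longrightarrow> lambda_map B a b \<in> carrier B"
  by (simp add: lambda_map_def)

lemma mult_eq_add_lambda:
  "a \<in> carrier B \<Longrightarrow> b \<in> carrier B \<Longrightarrow> a \<otimes>\<^bsub>B\<^esub> b = a \<oplus>\<^bsub>B\<^esub> lambda_map B a b"
  by (simp add: lambda_map_def a_minus_def a_comm[of _ "\<ominus>\<^bsub>B\<^esub> a"] r_neg2)

lemma lambda_eqI:
  "a \<in> carrier B \<Longrightarrow> b \<in> carrier B \<Longrightarrow> c \<in> carrier B \<Longrightarrow> a \<otimes>\<^bsub>B\<^esub> b = a \<oplus>\<^bsub>B\<^esub> c \<Longrightarrow> lambda_map B a b = c"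
  by (simp add: lambda_map_def a_minus_def a_comm[of _ "\<ominus>\<^bsub>B\<^esub> a"] r_neg1)

lemma lambda_one [simp]: "b \<in> carrier B \<Longrightarrow> lambda_map B \<one>\<^bsub>B\<^esub> b = b"
  using l_zero[of b] by (intro lambda_eqI) (auto simp: zero_eq_one)

lemma lambda_add:
  assumes "a \<in> carrier B" "b \<in> carrier B" "c \<in> carrier B"
  shows "lambda_map B a (b \<oplus>\<^bsub>B\<^esub> c) = lambda_map B a b \<oplus>\<^bsub>B\<^esub> lambda_map B a c"
proof (rule lambda_eqI)
  have "a \<otimes>\<^bsub>B\<^esub> (b \<oplus>\<^bsub>B\<^esub> c) \<oplus>\<^bsub>B\<^esub> a = (a \<oplus>\<^bsub>B\<^esub> (lambda_map B a b \<oplus>\<^bsub>B\<^esub> lambda_map B a c)) \<oplus>\<^bsub>B\<^esub> a"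
    using assms brace_law[OF assms] by (simp add: mult_eq_add_lambda a_ac)
  then show "a \<otimes>\<^bsub>B\<^esub> (b \<oplus>\<^bsub>B\<^esub> c) = a \<oplus>\<^bsub>B\<^esub> (lambda_map B a b \<oplus>\<^bsub>B\<^esub> lambda_map B a c)"
    using assms by (simp add: add.right_cancel)
qed (use assms in auto)

lemma lambda_mult:
  assumes "a \<in> carrier B" "b \<in> carrier B" "c \<in> carrier B"
  shows "lambda_map B (a \<otimes>\<^bsub>B\<^esub> b) c = lambda_map B a (lambda_map B b c)"
proof (rule lambda_eqI)
  have "a \<otimes>\<^bsub>B\<^esub> b \<otimes>\<^bsub>B\<^esub> c = a \<otimes>\<^bsub>B\<^esub> (b \<oplus>\<^bsub>B\<^esub> lambda_map B b c)"
    using assms by (simp add: m_assoc mult_eq_add_lambda[of b c])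
  also have "\<dots> = a \<oplus>\<^bsub>B\<^esub> lambda_map B a b \<oplus>\<^bsub>B\<^esub> lambda_map B a (lambda_map B b c)"
    using assms by (simp add: mult_eq_add_lambda[of a "b \<oplus>\<^bsub>B\<^esub> _"] lambda_add a_assoc)
  finally show "a \<otimes>\<^bsub>B\<^esub> b \<otimes>\<^bsub>B\<^esub> c = a \<otimes>\<^bsub>B\<^esub> b \<oplus>\<^bsub>B\<^esub> lambda_map B a (lambda_map B b c)"
    using assms by (simp add: mult_eq_add_lambda[of a b])
qed (use assms in auto)

end

lemma Fp_simps:
  "carrier (Fp q) = {0..<int q}" "x \<oplus>\<^bsub>Fp q\<^esub> y = (x + y) mod int q"
  "x \<otimes>\<^bsub>Fp q\<^esub> y = (x * y) mod int q" "\<zero>\<^bsub>Fp q\<^esub> = 0" "\<one>\<^bsub>Fp q\<^esub> = 1"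
  by (auto simp: Fp_def residue_ring_def)

section \<open>The wreath product modulo constants\<close>

text \<open>
  The bound \<open>card (carrier G) > 2\<close> excludes the one case in which a nontrivial permutation of the
  points can act trivially on functions modulo constants: two points and \<open>q = 2\<close>.
\<close>

locale wreath_step = left_brace G for G :: "'a ring" (structure) +
  fixes q :: nat
  assumes prime_q: "Factorial_Ring.prime q"
    and finite_G: "finite (carrier G)"
    and card_gt_2: "card (carrier G) > 2"
    and card_cong_1: "[int (card (carrier G)) = 1] (mod int q)"
begin

abbreviation "W \<equiv> wreath_quot G (Fp q)"
abbreviation "Q \<equiv> relabel W"

text \<open>
  Any integer-valued function, reduced modulo \<open>q\<close> and restricted to the carrier, represents a class.
  Allowing arbitrary representatives turns all identities between elements of the quotient into
  pointwise identities of integers, with \<open>mk h g\<close> the element with components the class of \<open>h\<close> and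
  \<open>g\<close>, transported along the renaming into the integers.
\<close>

definition fcoset :: "('a \<Rightarrow> int) \<Rightarrow> ('a \<Rightarrow> int) set" where
  "fcoset h = range (\<lambda>c. \<lambda>x\<in>carrier G. (h x + c) mod int q)"

definition mk :: "('a \<Rightarrow> int) \<Rightarrow> 'a \<Rightarrow> int" where
  "mk h g = enc (carrier W) (fcoset h \<times> {g})"

lemma q_gt_1: "int q > 1"
  using prime_q prime_gt_1_nat by auto

lemma residues_eq_range: "{0..<int q} = range (\<lambda>c. c mod int q)"
proof (intro equalityI subsetI)
  fix c assume "c \<in> {0..<int q}"
  then have "c = c mod int q" by simp
  then show "c \<in> range (\<lambda>c. c mod int q)" by (rule range_eqI)
qed (use q_gt_1 in auto)

lemma mod_add_mod: "((a + c) mod int q + (b + d) mod int q) mod int q = (a + b + (c + d)) mod int q"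
  by (simp only: mod_add_eq) (simp add: add_ac)

lemma fcoset_eq_iff:
  "fcoset h = fcoset h' \<longleftrightarrow> (\<exists>c. \<forall>x\<in>carrier G. [h x = h' x + c] (mod int q))"
proof
  assume "fcoset h = fcoset h'"
  moreover have "(\<lambda>x\<in>carrier G. (h x + 0) mod int q) \<in> fcoset h" unfolding fcoset_def by blast
  ultimately obtain c where
    "(\<lambda>x\<in>carrier G. (h x + 0) mod int q) = (\<lambda>x\<in>carrier G. (h' x + c) mod int q)"
    unfolding fcoset_def by auto
  then have "\<forall>x\<in>carrier G. [h x = h' x + c] (mod int q)"
    unfolding cong_def by (metis (mono_tags, lifting) add.right_neutral restrict_apply')
  then show "\<exists>c. \<forall>x\<in>carrier G. [h x = h' x + c] (mod int q)" ..
next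
  assume "\<exists>c. \<forall>x\<in>carrier G. [h x = h' x + c] (mod int q)"
  then obtain c where c: "\<And>x. x \<in> carrier G \<Longrightarrow> [h x = h' x + c] (mod int q)" by auto
  have 1: "(\<lambda>x\<in>carrier G. (h x + d) mod int q) = (\<lambda>x\<in>carrier G. (h' x + (c + d)) mod int q)" for d
    using cong_add[OF c cong_refl, of _ d] by (auto simp: cong_def add_ac)
  have 2: "(\<lambda>x\<in>carrier G. (h' x + d) mod int q) = (\<lambda>x\<in>carrier G. (h x + (d - c)) mod int q)" for d
    using 1[of "d - c"] by simp
  show "fcoset h = fcoset h'"
    unfolding fcoset_def
  proof (intro equalityI image_subsetI)
    fix d
    show "(\<lambda>x\<in>carrier G. (h x + d) mod int q) \<in> range (\<lambda>d. \<lambda>x\<in>carrier G. (h' x + d) mod int q)"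
      by (rule range_eqI, rule 1)
    show "(\<lambda>x\<in>carrier G. (h' x + d) mod int q) \<in> range (\<lambda>d. \<lambda>x\<in>carrier G. (h x + d) mod int q)"
      by (rule range_eqI, rule 2)
  qed
qed

lemma fcoset_cong: "(\<And>x. x \<in> carrier G \<Longrightarrow> [h x = h' x] (mod int q)) \<Longrightarrow> fcoset h = fcoset h'"
  unfolding fcoset_eq_iff by (rule exI[of _ 0]) simp

lemma fun_brace_simps:
  "carrier (fun_brace G (Fp q)) = carrier G \<rightarrow>\<^sub>E {0..<int q}"
  "f \<oplus>\<^bsub>fun_brace G (Fp q)\<^esub> f' = (\<lambda>x\<in>carrier G. (f x + f' x) mod int q)"
  "f \<otimes>\<^bsub>fun_brace G (Fp q)\<^esub> f' = (\<lambda>x\<in>carrier G. (f x + f' x) mod int q)"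
  "\<one>\<^bsub>fun_brace G (Fp q)\<^esub> = (\<lambda>x\<in>carrier G. 0)"
  "\<zero>\<^bsub>fun_brace G (Fp q)\<^esub> = (\<lambda>x\<in>carrier G. 0)"
  by (simp_all add: fun_brace_def trivial_brace_def Fp_simps)

lemma wreath_simps:
  "carrier (wreath_brace G (Fp q)) = (carrier G \<rightarrow>\<^sub>E {0..<int q}) \<times> carrier G"
  "(f, g) \<oplus>\<^bsub>wreath_brace G (Fp q)\<^esub> (f', g') = (\<lambda>x\<in>carrier G. (f x + f' x) mod int q, g \<oplus> g')"
  "(f, g) \<otimes>\<^bsub>wreath_brace G (Fp q)\<^esub> (f', g') =
     (\<lambda>x\<in>carrier G. (f x + f' (inv g \<otimes> x)) mod int q, g \<otimes> g')"
  "\<one>\<^bsub>wreath_brace G (Fp q)\<^esub> = (\<lambda>x\<in>carrier G. 0, \<one>)"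
  "\<zero>\<^bsub>wreath_brace G (Fp q)\<^esub> = (\<lambda>x\<in>carrier G. 0, \<zero>)"
  by (auto simp add: wreath_brace_def semidirect_brace_def fun_brace_simps translate_def)

text \<open>
  The cosets in the quotient are product sets because the ideal of constants is trivial in the second
  component; this is what reduces the quotient operations to formulas on representatives.
\<close>

lemma coset_eq:
  assumes "g \<in> carrier G"
  shows "const_ideal G (Fp q) +>\<^bsub>wreath_brace G (Fp q)\<^esub> (h, g) = fcoset h \<times> {g}"
proof -
  have "const_ideal G (Fp q) +>\<^bsub>wreath_brace G (Fp q)\<^esub> (h, g) =
    (\<lambda>c. (\<lambda>x\<in>carrier G. (c + h x) mod int q, g)) ` {0..<int q}"
  proof -
    have "const_ideal G (Fp q) = (\<lambda>c. (\<lambda>x\<in>carrier G. c, \<zero>)) ` {0..<int q}"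
      by (auto simp: const_ideal_def const_funs_def Fp_simps)
    then show ?thesis
      using assms by (simp add: a_r_coset_def' wreath_simps image_image UNION_singleton_eq_range
        cong: restrict_cong)
  qed
  also have "\<dots> = (\<lambda>c. (\<lambda>x\<in>carrier G. (c + h x) mod int q, g)) ` range (\<lambda>c. c mod int q)"
    by (simp only: residues_eq_range)
  also have "\<dots> = fcoset h \<times> {g}"
    by (auto simp: fcoset_def image_image mod_simps add_ac)
  finally show ?thesis .
qed

lemma fcoset_restrict: "fcoset (\<lambda>x\<in>carrier G. h x mod int q) = fcoset h"
  by (rule fcoset_cong) (simp add: cong_def)

lemma carrier_W_image:
  "carrier W = (\<lambda>(h, g). fcoset h \<times> {g}) ` ((carrier G \<rightarrow>\<^sub>E {0..<int q}) \<times> carrier G)"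
  by (auto simp: wreath_quot_def FactRing_def A_RCOSETS_def' wreath_simps UNION_singleton_eq_range
    coset_eq intro!: image_cong)

lemma finite_W: "finite (carrier W)"
  using finite_G by (simp add: carrier_W_image finite_PiE)

lemma carrier_W: "carrier W = {fcoset h \<times> {g} | h g. g \<in> carrier G}"
proof (intro equalityI subsetI)
  fix C assume "C \<in> {fcoset h \<times> {g} | h g. g \<in> carrier G}"
  then obtain h g where C: "C = fcoset h \<times> {g}" and g: "g \<in> carrier G" by auto
  have "(\<lambda>x\<in>carrier G. h x mod int q) \<in> carrier G \<rightarrow>\<^sub>E {0..<int q}"
    using q_gt_1 by auto
  moreover have "C = fcoset (\<lambda>x\<in>carrier G. h x mod int q) \<times> {g}"
    by (simp add: C fcoset_restrict)
  ultimately show "C \<in> carrier W"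
    unfolding carrier_W_image using g by (intro image_eqI[of _ _ "(_, g)"]) auto
qed (auto simp: carrier_W_image)

lemma fcoset_ne: "fcoset h \<noteq> {}" by (simp add: fcoset_def)

lemma mult_W:
  assumes "g \<in> carrier G" "g' \<in> carrier G"
  shows "(fcoset h \<times> {g}) \<otimes>\<^bsub>W\<^esub> (fcoset h' \<times> {g'}) =
    fcoset (\<lambda>x. h x + h' (inv g \<otimes> x)) \<times> {g \<otimes> g'}"
proof -
  let ?R = "fcoset (\<lambda>x. h x + h' (inv g \<otimes> x)) \<times> {g \<otimes> g'}"
  have "const_ideal G (Fp q) +>\<^bsub>wreath_brace G (Fp q)\<^esub> (a \<otimes>\<^bsub>wreath_brace G (Fp q)\<^esub> b) = ?R"
    if "a \<in> fcoset h \<times> {g}" "b \<in> fcoset h' \<times> {g'}" for a b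
  proof -
    obtain c c' where "a = (\<lambda>x\<in>carrier G. (h x + c) mod int q, g)"
      "b = (\<lambda>x\<in>carrier G. (h' x + c') mod int q, g')"
      using \<open>a \<in> _\<close> \<open>b \<in> _\<close> by (auto simp: fcoset_def)
    then have "const_ideal G (Fp q) +>\<^bsub>wreath_brace G (Fp q)\<^esub> (a \<otimes>\<^bsub>wreath_brace G (Fp q)\<^esub> b) =
      fcoset (\<lambda>x\<in>carrier G. (h x + h' (inv g \<otimes> x) + (c + c')) mod int q) \<times> {g \<otimes> g'}"
      using assms by (simp add: wreath_simps coset_eq mod_add_mod cong: restrict_cong)
    moreover have "fcoset (\<lambda>x\<in>carrier G. (h x + h' (inv g \<otimes> x) + (c + c')) mod int q) =
        fcoset (\<lambda>x. h x + h' (inv g \<otimes> x))"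
      unfolding fcoset_eq_iff by (rule exI[of _ "c + c'"]) (simp add: cong_def)
    ultimately show ?thesis by simp
  qed
  then have "(\<Union>a\<in>fcoset h \<times> {g}. \<Union>b\<in>fcoset h' \<times> {g'}.
     const_ideal G (Fp q) +>\<^bsub>wreath_brace G (Fp q)\<^esub> (a \<otimes>\<^bsub>wreath_brace G (Fp q)\<^esub> b)) =
     (\<Union>a\<in>fcoset h \<times> {g}. \<Union>b\<in>fcoset h' \<times> {g'}. ?R)"
    by (intro SUP_cong refl)
  also have "\<dots> = ?R"
    using fcoset_ne by auto
  finally show ?thesis
    by (simp add: wreath_quot_def FactRing_def rcoset_mult_def)
qed

lemma add_W:
  assumes "g \<in> carrier G" "g' \<in> carrier G"
  shows "(fcoset h \<times> {g}) \<oplus>\<^bsub>W\<^esub> (fcoset h' \<times> {g'}) = fcoset (\<lambda>x. h x + h' x) \<times> {g \<oplus> g'}"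
proof -
  have "(fcoset h \<times> {g}) \<oplus>\<^bsub>W\<^esub> (fcoset h' \<times> {g'}) =
     (\<Union>c. \<Union>c'. {(\<lambda>x\<in>carrier G. (h x + h' x + (c + c')) mod int q, g \<oplus> g')})"
    by (simp add: wreath_quot_def FactRing_def set_add_def' fcoset_def wreath_simps mod_add_mod
      Sigma_def cong: restrict_cong)
  also have "\<dots> = fcoset (\<lambda>x. h x + h' x) \<times> {g \<oplus> g'}"
  proof -
    have "(\<Union>c c'. {F (c + c' :: int)}) = range F" for F :: "int \<Rightarrow> ('a \<Rightarrow> int) \<times> 'a"
    proof -
      have "(\<exists>c c'. y = F (c + c')) \<longleftrightarrow> (\<exists>c. y = F c)" for y
        by (metis add.right_neutral)
      then show ?thesis by (simp add: set_eq_iff image_iff)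
    qed
    from this[of "\<lambda>c. (\<lambda>x\<in>carrier G. (h x + h' x + c) mod int q, g \<oplus> g')"]
    show ?thesis by (simp add: fcoset_def Sigma_def UNION_singleton_eq_range image_image)
  qed
  finally show ?thesis .
qed

lemma one_W: "\<one>\<^bsub>W\<^esub> = fcoset (\<lambda>_. 0) \<times> {\<one>}"
proof -
  have "fcoset (\<lambda>x\<in>carrier G. 0) = fcoset (\<lambda>_. 0)" by (rule fcoset_cong) simp
  then show ?thesis
    by (simp add: wreath_quot_def FactRing_def wreath_simps coset_eq)
qed

lemma zero_W: "\<zero>\<^bsub>W\<^esub> = fcoset (\<lambda>_. 0) \<times> {\<one>}"
proof -
  have "range (\<lambda>c. \<lambda>x\<in>carrier G. c mod int q) = (\<lambda>c. \<lambda>x\<in>carrier G. c) ` range (\<lambda>c. c mod int q)"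
    by (simp add: image_image)
  also have "\<dots> = const_funs G (Fp q)"
    unfolding residues_eq_range[symmetric] by (auto simp: const_funs_def Fp_simps)
  finally show ?thesis
    by (auto simp: wreath_quot_def FactRing_def const_ideal_def fcoset_def zero_eq_one)
qed

lemma fcoset_in_W [simp]: "g \<in> carrier G \<Longrightarrow> fcoset h \<times> {g} \<in> carrier W"
  by (auto simp: carrier_W)

lemma countable_W: "countable (carrier W)"
  using finite_W by (rule countable_finite)

lemma dec_mk [simp]: "g \<in> carrier G \<Longrightarrow> dec (carrier W) (mk h g) = fcoset h \<times> {g}"
  by (simp add: mk_def dec_enc countable_W)

lemma carrier_Q: "carrier Q = {mk h g | h g. g \<in> carrier G}"
  by (auto simp: relabel_def mk_def carrier_W)

lemma Q_cases [elim]: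
  assumes "x \<in> carrier Q"
  obtains h g where "x = mk h g" "g \<in> carrier G"
  using assms by (auto simp: carrier_Q)

lemma mk_closed [simp, intro]: "g \<in> carrier G \<Longrightarrow> mk h g \<in> carrier Q"
  by (auto simp: carrier_Q)

lemma mk_mult [simp]:
  "g \<in> carrier G \<Longrightarrow> g' \<in> carrier G \<Longrightarrow>
    mk h g \<otimes>\<^bsub>Q\<^esub> mk h' g' = mk (\<lambda>x. h x + h' (inv g \<otimes> x)) (g \<otimes> g')"
  by (simp add: relabel_def mult_W) (simp add: mk_def)

lemma mk_add [simp]:
  "g \<in> carrier G \<Longrightarrow> g' \<in> carrier G \<Longrightarrow> mk h g \<oplus>\<^bsub>Q\<^esub> mk h' g' = mk (\<lambda>x. h x + h' x) (g \<oplus> g')"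
  by (simp add: relabel_def add_W) (simp add: mk_def)

lemma one_Q: "\<one>\<^bsub>Q\<^esub> = mk (\<lambda>_. 0) \<one>"
  by (simp add: relabel_def one_W mk_def)

lemma zero_Q: "\<zero>\<^bsub>Q\<^esub> = mk (\<lambda>_. 0) \<one>"
  by (simp add: relabel_def zero_W mk_def)

lemma mk_eq_iff:
  assumes "g \<in> carrier G" "g' \<in> carrier G"
  shows "mk h g = mk h' g' \<longleftrightarrow> g = g' \<and> (\<exists>c. \<forall>x\<in>carrier G. [h x = h' x + c] (mod int q))"
proof -
  have "mk h g = mk h' g' \<longleftrightarrow> fcoset h \<times> {g} = fcoset h' \<times> {g'}"
    unfolding mk_def using assms by (intro inj_on_eq_iff[OF inj_on_enc[OF countable_W]]) auto
  also have "\<dots> \<longleftrightarrow> g = g' \<and> fcoset h = fcoset h'"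
    using fcoset_ne by (auto simp: times_eq_iff)
  finally show ?thesis by (simp add: fcoset_eq_iff)
qed

lemma mk_cong: "g = g' \<Longrightarrow> (\<And>x. x \<in> carrier G \<Longrightarrow> [h x = h' x] (mod int q)) \<Longrightarrow> mk h g = mk h' g'"
  unfolding mk_def using fcoset_cong[of h h'] by simp

lemma mk_cong_eq: "g = g' \<Longrightarrow> (\<And>x. x \<in> carrier G \<Longrightarrow> h x = h' x) \<Longrightarrow> mk h g = mk h' g'"
  by (rule mk_cong) auto

lemma group_Q: "group Q"
proof (rule groupI)
  fix x y z assume "x \<in> carrier Q" "y \<in> carrier Q" "z \<in> carrier Q"
  then show "x \<otimes>\<^bsub>Q\<^esub> y \<otimes>\<^bsub>Q\<^esub> z = x \<otimes>\<^bsub>Q\<^esub> (y \<otimes>\<^bsub>Q\<^esub> z)"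
    by (auto elim!: Q_cases intro!: mk_cong_eq simp: m_assoc inv_mult_group)
next
  fix x assume "x \<in> carrier Q"
  then show "\<one>\<^bsub>Q\<^esub> \<otimes>\<^bsub>Q\<^esub> x = x"
    by (auto elim!: Q_cases intro!: mk_cong_eq simp: one_Q)
next
  fix x assume "x \<in> carrier Q"
  then obtain h g where x: "x = mk h g" and g: "g \<in> carrier G" by auto
  show "\<exists>y\<in>carrier Q. y \<otimes>\<^bsub>Q\<^esub> x = \<one>\<^bsub>Q\<^esub>"
    using g by (intro bexI[of _ "mk (\<lambda>x. - h (g \<otimes> x)) (inv g)"]) (auto simp: x one_Q)
qed (auto elim!: Q_cases simp: one_Q)

lemma abelian_group_Q: "abelian_group Q"
proof (rule abelian_groupI)
  fix x y z assume "x \<in> carrier Q" "y \<in> carrier Q" "z \<in> carrier Q"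
  then show "x \<oplus>\<^bsub>Q\<^esub> y \<oplus>\<^bsub>Q\<^esub> z = x \<oplus>\<^bsub>Q\<^esub> (y \<oplus>\<^bsub>Q\<^esub> z)"
    by (auto elim!: Q_cases intro!: mk_cong_eq simp: a_assoc)
next
  fix x y assume "x \<in> carrier Q" "y \<in> carrier Q"
  then show "x \<oplus>\<^bsub>Q\<^esub> y = y \<oplus>\<^bsub>Q\<^esub> x"
    by (auto elim!: Q_cases intro!: mk_cong_eq simp: a_comm)
next
  fix x assume "x \<in> carrier Q"
  then show "\<zero>\<^bsub>Q\<^esub> \<oplus>\<^bsub>Q\<^esub> x = x"
    by (auto elim!: Q_cases intro!: mk_cong_eq simp: zero_Q simp flip: zero_eq_one)
next
  fix x assume "x \<in> carrier Q"
  then obtain h g where x: "x = mk h g" and g: "g \<in> carrier G" by auto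
  show "\<exists>y\<in>carrier Q. y \<oplus>\<^bsub>Q\<^esub> x = \<zero>\<^bsub>Q\<^esub>"
    using g by (intro bexI[of _ "mk (\<lambda>x. - h x) (\<ominus> g)"]) (auto simp: x zero_Q l_neg simp flip: zero_eq_one)
qed (auto elim!: Q_cases simp: zero_Q)

lemma left_brace_Q: "left_brace Q"
proof -
  interpret A: abelian_group Q by (rule abelian_group_Q)
  interpret M: group Q by (rule group_Q)
  show ?thesis
  proof
    fix a b c assume "a \<in> carrier Q" "b \<in> carrier Q" "c \<in> carrier Q"
    then show "a \<otimes>\<^bsub>Q\<^esub> (b \<oplus>\<^bsub>Q\<^esub> c) \<oplus>\<^bsub>Q\<^esub> a = a \<otimes>\<^bsub>Q\<^esub> b \<oplus>\<^bsub>Q\<^esub> a \<otimes>\<^bsub>Q\<^esub> c"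
      by (auto elim!: Q_cases intro!: mk_cong_eq simp: brace_law)
  qed
qed

end


context wreath_step begin

interpretation Q: left_brace Q by (rule left_brace_Q)

lemma mk_eq_one_iff:
  "g \<in> carrier G \<Longrightarrow>
    mk h g = \<one>\<^bsub>Q\<^esub> \<longleftrightarrow> g = \<one> \<and> (\<exists>c. \<forall>x\<in>carrier G. [h x = c] (mod int q))"
  by (simp add: one_Q mk_eq_iff)

lemma inv_mk: "g \<in> carrier G \<Longrightarrow> inv\<^bsub>Q\<^esub> (mk h g) = mk (\<lambda>x. - h (g \<otimes> x)) (inv g)"
  by (rule Q.inv_equality) (auto simp: one_Q)

lemma lambda_mk:
  assumes "g \<in> carrier G" "g' \<in> carrier G"
  shows "lambda_map Q (mk h g) (mk h' g') = mk (\<lambda>x. h' (inv g \<otimes> x)) (lambda_map G g g')"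
  using assms by (intro Q.lambda_eqI) (auto simp: mult_eq_add_lambda)

lemma section_hom: "(\<lambda>g. mk (\<lambda>_. 0) g) \<in> hom G Q"
  by (auto simp: hom_def)

lemma base_elem_fcoset [simp]: "base_elem (fcoset h \<times> {g}) = g"
  by (simp add: base_elem_def fcoset_ne)

lemma fun_class_fcoset [simp]: "fun_class (fcoset h \<times> {g}) = fcoset h"
  by (simp add: fun_class_def)

lemma base_hom: "(\<lambda>x. base_elem (dec (carrier W) x)) \<in> hom Q G"
  by (auto simp: hom_def elim!: Q_cases)

section \<open>Order of a wreath step and functions moved by a permutation\<close>

text \<open>
  Each class has exactly one representative that vanishes at \<open>\<one>\<close>.
\<close>

lemma card_Q: "card (carrier Q) = q ^ (card (carrier G) - 1) * card (carrier G)"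
proof -
  let ?P = "(carrier G - {\<one>}) \<rightarrow>\<^sub>E {0..<int q}"
  let ?f = "\<lambda>(h, g). mk (h(\<one> := 0)) g"
  have "bij_betw ?f (?P \<times> carrier G) (carrier Q)"
  proof (rule bij_betw_imageI)
    show "inj_on ?f (?P \<times> carrier G)"
    proof (rule inj_onI, clarsimp simp del: fun_upd_apply)
      fix h h' g g'
      assume h: "h \<in> ?P" and h': "h' \<in> ?P" and g: "g \<in> carrier G" "g' \<in> carrier G"
        and eq: "mk (h(\<one> := 0)) g = mk (h'(\<one> := 0)) g'"
      from eq g obtain c where "g = g'"
        and c: "\<And>x. x \<in> carrier G \<Longrightarrow> [(h(\<one> := 0)) x = (h'(\<one> := 0)) x + c] (mod int q)"
        unfolding mk_eq_iff[OF g] by auto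
      have c0: "[c = 0] (mod int q)" using c[of \<one>] by (simp add: cong_sym_eq)
      have "h x = h' x" for x
      proof (cases "x \<in> carrier G - {\<one>}")
        case True
        then have "[h x = h' x + c] (mod int q)" using c[of x] by auto
        also have "[h' x + c = h' x + 0] (mod int q)" using c0 by (intro cong_add) auto
        finally show ?thesis
          using True h h' by (auto simp: cong_def PiE_def Pi_def)
      qed (use h h' in \<open>metis PiE_arb\<close>)
      with \<open>g = g'\<close> show "h = h' \<and> g = g'" by auto
    qed
    show "?f ` (?P \<times> carrier G) = carrier Q"
    proof (intro equalityI subsetI)
      fix y assume "y \<in> carrier Q"
      then obtain h g where y: "y = mk h g" and g: "g \<in> carrier G" by auto
      let ?h = "\<lambda>x\<in>carrier G - {\<one>}. (h x - h \<one>) mod int q"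
      have "mk h g = mk (?h(\<one> := 0)) g"
        unfolding mk_eq_iff[OF g g]
        by (intro conjI refl exI[of _ "h \<one>"]) (auto simp: cong_def mod_simps)
      moreover have "?h \<in> ?P" using q_gt_1 by auto
      ultimately show "y \<in> ?f ` (?P \<times> carrier G)"
        unfolding y using g by (intro image_eqI[of _ _ "(?h, g)"]) auto
    qed auto
  qed
  then have "card (carrier Q) = card (?P \<times> carrier G)"
    by (simp add: bij_betw_same_card)
  also have "\<dots> = q ^ (card (carrier G) - 1) * card (carrier G)"
    using finite_G by (simp add: card_cartesian_product card_PiE)
  finally show ?thesis .
qed

lemma finite_Q: "finite (carrier Q)"
  using finite_W by (simp add: relabel_def)

lemma card_Q_gt_2: "card (carrier Q) > 2"
proof -
  have "1 * card (carrier G) \<le> q ^ (card (carrier G) - 1) * card (carrier G)"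
    using q_gt_1 by (intro mult_right_mono) auto
  then show ?thesis using card_gt_2 unfolding card_Q by linarith
qed

lemma card_Q_cong_1:
  assumes "[int q = 1] (mod int r)" "[int (card (carrier G)) = 1] (mod int r)"
  shows "[int (card (carrier Q)) = 1] (mod int r)"
  using cong_mult[OF cong_pow[OF assms(1)] assms(2)] by (simp add: card_Q)

lemma pow_card: "g \<in> carrier G \<Longrightarrow> g [^] card (carrier G) = \<one>"
  using pow_order_eq_1[of g] by (simp add: order_def)

text \<open>
  The indicator function of a moved point: its difference takes the value \<open>1\<close> there, and the
  value \<open>0\<close> at any point that is neither \<open>y\<close> nor the preimage of \<open>y\<close>.
\<close>

lemma moved_fun_nonconst:
  assumes \<sigma>: "inj_on \<sigma> (carrier G)" and y: "y \<in> carrier G" "\<sigma> y \<noteq> y"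
  shows "\<exists>h :: 'a \<Rightarrow> int. \<not> (\<exists>c. \<forall>x\<in>carrier G. [h x - h (\<sigma> x) = c] (mod int q))"
proof (intro exI notI)
  define h :: "'a \<Rightarrow> int" where "h = (\<lambda>x. if x = y then 1 else 0)"
  assume "\<exists>c. \<forall>x\<in>carrier G. [(if x = y then 1 else 0) - (if \<sigma> x = y then 1 else 0) = c] (mod int q)"
  then obtain c where c: "\<And>x. x \<in> carrier G \<Longrightarrow> [h x - h (\<sigma> x) = c] (mod int q)" by (auto simp: h_def)
  have "\<exists>x\<in>carrier G. x \<noteq> y \<and> \<sigma> x \<noteq> y"
  proof (rule ccontr)
    assume "\<not> ?thesis"
    then have "carrier G - {y} \<subseteq> {x \<in> carrier G. \<sigma> x = y}" by auto
    moreover have "card {x \<in> carrier G. \<sigma> x = y} \<le> card {y}"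
      using \<sigma> by (intro card_inj_on_le[of \<sigma>]) (auto simp: inj_on_def)
    ultimately have "card (carrier G - {y}) \<le> 1"
      using finite_G card_mono[of "{x \<in> carrier G. \<sigma> x = y}" "carrier G - {y}"] by simp
    then show False using card_gt_2 y finite_G by simp
  qed
  then obtain x where x: "x \<in> carrier G" "x \<noteq> y" "\<sigma> x \<noteq> y" by auto
  have "[1 = c] (mod int q)" using c[of y] y by (simp add: h_def)
  moreover have "[0 = c] (mod int q)" using c[of x] x by (simp add: h_def)
  ultimately have "[0 = 1] (mod int q)" using cong_sym cong_trans by blast
  then show False using q_gt_1 by (auto simp: cong_def)
qed

section \<open>Normal subgroups and derived series of a wreath step\<close>

lemma mk_sum_mem:
  assumes "subgroup M Q" "finite S" "\<And>s. s \<in> S \<Longrightarrow> mk (f s) \<one> \<in> M"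
  shows "mk (\<lambda>x. \<Sum>s\<in>S. f s x) \<one> \<in> M"
  using assms(2,3)
proof (induction S rule: finite_induct)
  case empty
  then show ?case using subgroup.one_closed[OF assms(1)] by (simp add: one_Q)
next
  case (insert s S)
  then have "mk (f s) \<one> \<otimes>\<^bsub>Q\<^esub> mk (\<lambda>x. \<Sum>s\<in>S. f s x) \<one> \<in> M"
    by (intro subgroup.m_closed[OF assms(1)]) auto
  moreover have "mk (f s) \<one> \<otimes>\<^bsub>Q\<^esub> mk (\<lambda>x. \<Sum>s\<in>S. f s x) \<one> = mk (\<lambda>x. \<Sum>s\<in>insert s S. f s x) \<one>"
    using insert.hyps by (auto intro!: mk_cong_eq)
  ultimately show ?case by simp
qed

lemma commutator_mk:
  assumes "k \<in> carrier G"
  shows "mk h \<one> \<otimes>\<^bsub>Q\<^esub> mk (\<lambda>_. 0) k \<otimes>\<^bsub>Q\<^esub> inv\<^bsub>Q\<^esub> (mk h \<one>) \<otimes>\<^bsub>Q\<^esub> inv\<^bsub>Q\<^esub> (mk (\<lambda>_. 0) k) =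
    mk (\<lambda>x. h x - h (inv k \<otimes> x)) \<one>"
  using assms by (auto simp: inv_mk intro!: mk_cong_eq)

text \<open>
  Functions modulo constants have no nonzero coinvariants under \<open>G\<close>: up to the constant \<open>\<Sum>\<^sub>g f g\<close>,
  the commutators \<open>f - g f\<close> add up to \<open>|G| f\<close>, which is \<open>f\<close> modulo \<open>q\<close>.
\<close>

lemma normal_section_imp_all:
  assumes M: "M \<lhd> Q" and sec: "\<And>g. g \<in> carrier G \<Longrightarrow> mk (\<lambda>_. 0) g \<in> M"
  shows "M = carrier Q"
proof -
  have sub: "subgroup M Q" using M by (rule normal_imp_subgroup)
  have 1: "mk (\<lambda>x. f x - f (inv g \<otimes> x)) \<one> \<in> M" if "g \<in> carrier G" for f g
  proof -
    have "mk f \<one> \<otimes>\<^bsub>Q\<^esub> mk (\<lambda>_. 0) g \<otimes>\<^bsub>Q\<^esub> inv\<^bsub>Q\<^esub> (mk f \<one>) \<in> M"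
      using M sec[OF that] by (intro normal.inv_op_closed2) auto
    then have "mk f \<one> \<otimes>\<^bsub>Q\<^esub> mk (\<lambda>_. 0) g \<otimes>\<^bsub>Q\<^esub> inv\<^bsub>Q\<^esub> (mk f \<one>) \<otimes>\<^bsub>Q\<^esub> inv\<^bsub>Q\<^esub> (mk (\<lambda>_. 0) g) \<in> M"
      by (rule subgroup.m_closed[OF sub _ subgroup.m_inv_closed[OF sub sec[OF that]]])
    then show ?thesis using that by (simp add: commutator_mk del: mk_mult)
  qed
  have 2: "mk f \<one> \<in> M" for f
  proof -
    have "mk (\<lambda>x. \<Sum>g\<in>carrier G. f x - f (inv g \<otimes> x)) \<one> \<in> M"
      using 1 by (intro mk_sum_mem[OF sub finite_G])
    moreover have "mk (\<lambda>x. \<Sum>g\<in>carrier G. f x - f (inv g \<otimes> x)) \<one> = mk f \<one>"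
      unfolding mk_eq_iff[OF one_closed one_closed]
    proof (intro conjI refl exI[of _ "- (\<Sum>g\<in>carrier G. f g)"] ballI)
      fix x assume x: "x \<in> carrier G"
      have "(\<Sum>g\<in>carrier G. f (inv g \<otimes> x)) = (\<Sum>g\<in>carrier G. f g)"
      proof (rule sum.reindex_bij_witness[of _ "\<lambda>g. x \<otimes> inv g" "\<lambda>g. inv g \<otimes> x"])
        show "x \<otimes> inv (inv g \<otimes> x) = g" if "g \<in> carrier G" for g
          using that x by (simp add: inv_mult_group m_assoc[symmetric])
      qed (use x in \<open>auto simp: inv_mult_group m_assoc\<close>)
      then have "(\<Sum>g\<in>carrier G. f x - f (inv g \<otimes> x)) = int (card (carrier G)) * f x - (\<Sum>g\<in>carrier G. f g)"
        by (simp add: sum_subtractf)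
      also have "[\<dots> = 1 * f x - (\<Sum>g\<in>carrier G. f g)] (mod int q)"
        using card_cong_1 by (intro cong_diff cong_mult) auto
      finally show "[(\<Sum>g\<in>carrier G. f x - f (inv g \<otimes> x)) = f x + - (\<Sum>g\<in>carrier G. f g)] (mod int q)"
        by simp
    qed
    ultimately show ?thesis by simp
  qed
  have "x \<in> M" if xQ: "x \<in> carrier Q" for x
  proof -
    obtain h g where x: "x = mk h g" and g: "g \<in> carrier G" using xQ by auto
    have "mk h \<one> \<otimes>\<^bsub>Q\<^esub> mk (\<lambda>_. 0) g \<in> M"
      using 2 sec[OF g] by (intro subgroup.m_closed[OF sub])
    then show ?thesis using g by (simp add: x)
  qed
  then show ?thesis using subgroup.subset[OF sub] by auto
qed

lemma derived_section:
  assumes "k \<in> (derived G ^^ d) (carrier G)"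
  shows "mk (\<lambda>_. 0) k \<in> (derived Q ^^ d) (carrier Q)"
proof -
  interpret S: group_hom G Q "\<lambda>g. mk (\<lambda>_. 0) g"
    using section_hom by unfold_locales
  have "(\<lambda>g. mk (\<lambda>_. 0) g) ` ((derived G ^^ d) (carrier G)) = (derived Q ^^ d) ((\<lambda>g. mk (\<lambda>_. 0) g) ` carrier G)"
    by (rule S.exp_of_derived_img[symmetric]) simp
  also have "\<dots> \<subseteq> (derived Q ^^ d) (carrier Q)"
    by (rule Q.mono_exp_of_derived) auto
  finally show ?thesis using assms by auto
qed

lemma derived_commutator:
  assumes "a \<in> (derived Q ^^ d) (carrier Q)" "b \<in> (derived Q ^^ d) (carrier Q)"
  shows "a \<otimes>\<^bsub>Q\<^esub> b \<otimes>\<^bsub>Q\<^esub> inv\<^bsub>Q\<^esub> a \<otimes>\<^bsub>Q\<^esub> inv\<^bsub>Q\<^esub> b \<in> (derived Q ^^ Suc d) (carrier Q)"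
  unfolding funpow.simps o_def using assms by (rule commutator_in_derived)

text \<open>
  Commuting with \<open>k\<close> once per derived step would only give the image of a power of \<open>k - 1\<close>.  No power
  is lost, because every \<open>h - k h\<close> is also of the form \<open>f - k f\<close> for an \<open>f\<close> that is itself
  a sum of such differences: take \<open>f\<close> to be \<open>h\<close> minus its average over the cyclic group generated
  by \<open>k\<close>, which \<open>k\<close> fixes.
\<close>

lemma derived_displacement:
  assumes "k \<in> (derived G ^^ d) (carrier G)"
  shows "mk (\<lambda>x. h x - h (inv k \<otimes> x)) \<one> \<in> (derived Q ^^ Suc d) (carrier Q)"
  using assms
proof (induction d arbitrary: k h)
  case 0
  then show ?case
    using derived_commutator[of "mk h \<one>" 0 "mk (\<lambda>_. 0) k"]
    by (simp add: commutator_mk del: mk_mult)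
next
  case (Suc d)
  let ?m = "card (carrier G)"
  have subG: "subgroup ((derived G ^^ e) (carrier G)) G" for e
    by (rule exp_of_derived_is_subgroup[OF subgroup_self])
  have subQ: "subgroup ((derived Q ^^ e) (carrier Q)) Q" for e
    by (rule Q.exp_of_derived_is_subgroup[OF Q.subgroup_self])
  have k: "k \<in> carrier G" using Suc.prems subgroup.subset[OF subG] by blast
  have k': "k \<in> (derived G ^^ d) (carrier G)"
    using Suc.prems derived_incl[OF order_refl subG[of d]] by auto
  \<comment> \<open>Since \<open>?m \<equiv> 1\<close>, this is \<open>h\<close> minus a sum over \<open>i < ?m\<close> that \<open>k\<close> fixes because its power \<open>?m\<close> is \<open>1\<close>.\<close>
  define f where "f = (\<lambda>x. \<Sum>i<?m. h x - h (inv (k [^] i) \<otimes> x))"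
  have "k [^] i \<in> (derived G ^^ d) (carrier G)" for i :: nat
    using k' subG[of d] by (induction i) (auto simp: subgroup.one_closed subgroup.m_closed)
  then have "mk f \<one> \<in> (derived Q ^^ Suc d) (carrier Q)"
    unfolding f_def using Suc.IH by (intro mk_sum_mem[OF subQ]) auto
  from derived_commutator[OF this derived_section[OF Suc.prems]]
  have "mk (\<lambda>x. f x - f (inv k \<otimes> x)) \<one> \<in> (derived Q ^^ Suc (Suc d)) (carrier Q)"
    using k by (simp only: commutator_mk)
  moreover have "mk (\<lambda>x. f x - f (inv k \<otimes> x)) \<one> = mk (\<lambda>x. h x - h (inv k \<otimes> x)) \<one>"
  proof (rule mk_cong[OF refl])
    fix x assume x: "x \<in> carrier G"
    let ?t = "\<lambda>i::nat. h (inv (k [^] i) \<otimes> x)"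
    have "inv (k [^] i) \<otimes> (inv k \<otimes> x) = inv (k [^] Suc i) \<otimes> x" for i :: nat
      using k x by (simp add: m_assoc[symmetric] inv_mult_group[symmetric] nat_pow_Suc2[symmetric] del: nat_pow_Suc)
    then have "f x - f (inv k \<otimes> x) = (\<Sum>i<?m. h x - h (inv k \<otimes> x)) - ((\<Sum>i<?m. ?t i) - (\<Sum>i<?m. ?t (Suc i)))"
      by (simp add: f_def sum_subtractf algebra_simps)
    also have "(\<Sum>i<?m. ?t i) - (\<Sum>i<?m. ?t (Suc i)) = ?t 0 - ?t ?m"
      unfolding sum_subtractf[symmetric] by (rule sum_lessThan_telescope')
    also have "\<dots> = 0" using k by (simp add: pow_card)
    also have "(\<Sum>i<?m. h x - h (inv k \<otimes> x)) - 0 = int ?m * (h x - h (inv k \<otimes> x))"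
      by simp
    also have "[\<dots> = 1 * (h x - h (inv k \<otimes> x))] (mod int q)"
      using card_cong_1 by (intro cong_mult) auto
    finally show "[f x - f (inv k \<otimes> x) = h x - h (inv k \<otimes> x)] (mod int q)" by simp
  qed
  ultimately show ?case by simp
qed

lemma derived_Q_nontrivial:
  assumes "(derived G ^^ d) (carrier G) \<noteq> {\<one>}"
  shows "(derived Q ^^ Suc d) (carrier Q) \<noteq> {\<one>\<^bsub>Q\<^esub>}"
proof -
  have sub: "subgroup ((derived G ^^ d) (carrier G)) G"
    by (rule exp_of_derived_is_subgroup[OF subgroup_self])
  obtain k where k: "k \<in> (derived G ^^ d) (carrier G)" "k \<noteq> \<one>"
    using assms subgroup.one_closed[OF sub] by blast
  then have kG: "k \<in> carrier G" using subgroup.subset[OF sub] by auto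
  have "inv k \<noteq> \<one>" using k kG by (metis inv_inv inv_one)
  moreover have "inj_on ((\<otimes>) (inv k)) (carrier G)"
    using kG by (auto simp: inj_on_def)
  ultimately obtain h :: "'a \<Rightarrow> int" where "\<not> (\<exists>c. \<forall>x\<in>carrier G. [h x - h (inv k \<otimes> x) = c] (mod int q))"
    using moved_fun_nonconst[of "(\<otimes>) (inv k)" \<one>] kG by auto
  then have "mk (\<lambda>x. h x - h (inv k \<otimes> x)) \<one> \<noteq> \<one>\<^bsub>Q\<^esub>"
    by (simp add: mk_eq_one_iff)
  then show ?thesis using derived_displacement[OF k(1), of h] by auto
qed

text \<open>
  The projection to \<open>G\<close> kills the \<open>d\<close>-th derived subgroup, which therefore lies in the abelian
  subgroup of classes of functions.
\<close>

lemma derived_Q_trivial: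
  assumes "(derived G ^^ d) (carrier G) = {\<one>}"
  shows "(derived Q ^^ Suc d) (carrier Q) = {\<one>\<^bsub>Q\<^esub>}"
proof -
  let ?D = "(derived Q ^^ d) (carrier Q)" and ?b = "\<lambda>x. base_elem (dec (carrier W) x)"
  interpret P: group_hom Q G ?b
    using base_hom by unfold_locales
  have sub: "subgroup ((derived Q ^^ e) (carrier Q)) Q" for e
    by (rule Q.exp_of_derived_is_subgroup[OF Q.subgroup_self])
  have "?b ` ?D = (derived G ^^ d) (?b ` carrier Q)"
    by (rule P.exp_of_derived_img[symmetric]) simp
  also have "\<dots> \<subseteq> (derived G ^^ d) (carrier G)"
    by (rule mono_exp_of_derived) auto
  finally have "?b ` ?D \<subseteq> {\<one>}" using assms by simp
  then have D: "\<exists>h. x = mk h \<one>" if "x \<in> ?D" for x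
  proof -
    have "x \<in> carrier Q" using that subgroup.subset[OF sub[of d]] by blast
    then obtain h g where x: "x = mk h g" "g \<in> carrier G" by auto
    moreover have "?b x = \<one>" using \<open>?b ` ?D \<subseteq> {\<one>}\<close> that by blast
    ultimately show ?thesis by auto
  qed
  have "derived_set Q ?D \<subseteq> {\<one>\<^bsub>Q\<^esub>}"
  proof clarify
    fix a b assume "a \<in> ?D" "b \<in> ?D"
    then obtain h h' where "a = mk h \<one>" "b = mk h' \<one>" using D by meson
    then show "a \<otimes>\<^bsub>Q\<^esub> b \<otimes>\<^bsub>Q\<^esub> inv\<^bsub>Q\<^esub> a \<otimes>\<^bsub>Q\<^esub> inv\<^bsub>Q\<^esub> b = \<one>\<^bsub>Q\<^esub>"
      by (auto simp: inv_mk one_Q intro!: mk_cong_eq)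
  qed
  then have "derived Q ?D \<subseteq> {\<one>\<^bsub>Q\<^esub>}"
    unfolding derived_def by (rule Q.generate_subgroup_incl) (rule Q.triv_subgroup)
  moreover have "\<one>\<^bsub>Q\<^esub> \<in> derived Q ?D"
    using subgroup.one_closed[OF sub[of "Suc d"]] by simp
  ultimately show ?thesis by auto
qed

section \<open>The bilinear form on classes of functions\<close>

text \<open>
  The form \<open>b\<^sub>j\<close> before reduction modulo \<open>q\<close>.
\<close>

definition fun_form :: "('a \<Rightarrow> int) \<Rightarrow> ('a \<Rightarrow> int) \<Rightarrow> int" where
  "fun_form h h' = (\<Sum>x\<in>carrier G. h x) * (\<Sum>x\<in>carrier G. h' x) - (\<Sum>x\<in>carrier G. h x * h' x)"

text \<open>
  Adding constants changes the value by a multiple of \<open>|G| - 1\<close>.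
\<close>

lemma fun_form_shift:
  assumes "\<And>x. x \<in> carrier G \<Longrightarrow> [f x = h x + c] (mod int q)"
    and "\<And>x. x \<in> carrier G \<Longrightarrow> [f' x = h' x + c'] (mod int q)"
  shows "[fun_form f f' = fun_form h h'] (mod int q)"
proof -
  let ?m = "int (card (carrier G))"
  have "[fun_form f f' = fun_form (\<lambda>x. h x + c) (\<lambda>x. h' x + c')] (mod int q)"
    unfolding fun_form_def using assms by (intro cong_diff cong_mult cong_sum) auto
  also have "fun_form (\<lambda>x. h x + c) (\<lambda>x. h' x + c') =
    fun_form h h' + (?m - 1) * (c' * (\<Sum>x\<in>carrier G. h x) + c * (\<Sum>x\<in>carrier G. h' x) + ?m * c * c')"
  proof -
    have "(\<Sum>x\<in>carrier G. (h x + c) * (h' x + c')) = (\<Sum>x\<in>carrier G. h x * h' x)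
      + c' * (\<Sum>x\<in>carrier G. h x) + c * (\<Sum>x\<in>carrier G. h' x) + ?m * c * c'"
      by (simp add: algebra_simps sum.distrib sum_distrib_left)
    then show ?thesis
      by (simp add: fun_form_def sum.distrib) (simp add: algebra_simps)
  qed
  also have "[\<dots> = fun_form h h' + (1 - 1) * (c' * (\<Sum>x\<in>carrier G. h x) + c * (\<Sum>x\<in>carrier G. h' x) + ?m * c * c')] (mod int q)"
    using card_cong_1 by (intro cong_add cong_mult cong_diff) auto
  finally show ?thesis by simp
qed

lemma bform_quot_fcoset: "bform_quot G (Fp q) (fcoset h) (fcoset h') = fun_form h h' mod int q"
proof -
  interpret R: residues "int q" "Fp q"
    using q_gt_1 by unfold_locales (simp_all add: Fp_def)
  have ex: "\<exists>c. (SOME f. f \<in> fcoset h) = (\<lambda>x\<in>carrier G. (h x + c) mod int q)" for h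
    using someI_ex[of "\<lambda>f. f \<in> fcoset h"] fcoset_ne[of h] unfolding fcoset_def by blast
  obtain c c' where c: "(SOME f. f \<in> fcoset h) = (\<lambda>x\<in>carrier G. (h x + c) mod int q)"
    "(SOME f. f \<in> fcoset h') = (\<lambda>x\<in>carrier G. (h' x + c') mod int q)"
    using ex by meson
  have aug: "aug G (Fp q) (\<lambda>x\<in>carrier G. f x mod int q) = (\<Sum>x\<in>carrier G. f x) mod int q" for f
  proof -
    have "aug G (Fp q) (\<lambda>x\<in>carrier G. f x mod int q) = (\<Oplus>\<^bsub>Fp q\<^esub>x\<in>carrier G. f x mod int q)"
      unfolding aug_def by (rule R.finsum_cong') auto
    then show ?thesis using finite_G by (simp add: R.sum_cong)
  qed
  have "bform_quot G (Fp q) (fcoset h) (fcoset h') = fun_form (\<lambda>x. h x + c) (\<lambda>x. h' x + c') mod int q"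
    unfolding bform_quot_def bform_def c
    by (simp add: aug R.mult_cong a_minus_def R.neg_cong R.add_cong fun_form_def cong: restrict_cong)
  also have "\<dots> = fun_form h h' mod int q"
    using fun_form_shift[of "\<lambda>x. h x + c" h c "\<lambda>x. h' x + c'" h' c'] by (simp add: cong_def)
  finally show ?thesis .
qed

lemma fun_form_commute: "fun_form h h' = fun_form h' h"
  by (simp add: fun_form_def mult.commute)

lemma fun_form_add_left: "fun_form (\<lambda>x. h x + h' x) k = fun_form h k + fun_form h' k"
  by (simp add: fun_form_def sum.distrib algebra_simps)

lemma fun_form_reindex:
  assumes "bij_betw \<sigma> (carrier G) (carrier G)"
  shows "fun_form (\<lambda>x. h (\<sigma> x)) (\<lambda>x. h' (\<sigma> x)) = fun_form h h'"
  using sum.reindex_bij_betw[OF assms, of h] sum.reindex_bij_betw[OF assms, of h']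
    sum.reindex_bij_betw[OF assms, of "\<lambda>x. h x * h' x"] by (simp add: fun_form_def)

text \<open>
  Pairing \<open>h\<close> with the indicator function of \<open>y\<close> gives \<open>\<epsilon>(h) - h(y)\<close>, which vanishes for all \<open>y\<close> only
  if \<open>h\<close> is constant.
\<close>

lemma fun_form_nondegenerate:
  assumes "\<not> (\<exists>c. \<forall>x\<in>carrier G. [h x = c] (mod int q))"
  obtains h' where "fun_form h h' mod int q \<noteq> 0"
proof -
  obtain y where y: "y \<in> carrier G" "\<not> [h y = (\<Sum>x\<in>carrier G. h x)] (mod int q)"
    using assms by blast
  have "fun_form h (\<lambda>x. if x = y then 1 else 0) = (\<Sum>x\<in>carrier G. h x) - h y"
    using finite_G y by (simp add: fun_form_def if_distrib sum.delta cong: if_cong)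
  moreover have "((\<Sum>x\<in>carrier G. h x) - h y) mod int q \<noteq> 0"
    using y(2) by (metis cong_iff_dvd_diff cong_sym dvd_eq_mod_eq_0)
  ultimately show ?thesis using that by metis
qed

text \<open>
  The map \<open>\<psi>\<close> plays the role of the inverse of \<open>\<phi>\<close>; for an action it is the action of the negative,
  which avoids \<^const>\<open>inv_into\<close>.
\<close>

lemma wreath_quot_map_fcoset:
  assumes \<phi>: "bij_betw \<phi> (carrier G) (carrier G)" and \<psi>: "\<And>x. x \<in> carrier G \<Longrightarrow> \<psi> x \<in> carrier G \<and> \<phi> (\<psi> x) = x"
    and g: "g \<in> carrier G"
  shows "wreath_quot_map G \<phi> (fcoset h \<times> {g}) = fcoset (\<lambda>x. h (\<psi> x)) \<times> {\<phi> g}"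
proof -
  have "inv_into (carrier G) \<phi> x = \<psi> x" if "x \<in> carrier G" for x
    using \<phi> \<psi>[OF that] by (metis bij_betw_imp_inj_on inv_into_f_f)
  then have "hat_map G \<phi> ` fcoset h = fcoset (\<lambda>x. h (\<psi> x))"
    using \<psi> by (simp add: fcoset_def hat_map_def image_image cong: restrict_cong)
  then show ?thesis
    by (simp add: wreath_quot_map_def fun_class_def base_elem_def fcoset_ne)
qed

end


section \<open>Ideals and asymmetric products\<close>

context left_brace begin

lemma brace_ideal_add_closed:
  assumes N: "brace_ideal N B" and "a \<in> N" "b \<in> N"
  shows "a \<oplus>\<^bsub>B\<^esub> b \<in> N"
proof -
  have sub: "subgroup N B" using N normal_imp_subgroup by (auto simp: brace_ideal_def)
  have ab: "a \<in> carrier B" "b \<in> carrier B" using assms subgroup.subset[OF sub] by auto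
  have "a \<otimes>\<^bsub>B\<^esub> lambda_map B (inv\<^bsub>B\<^esub> a) b \<in> N"
    using N assms(2,3) ab by (intro subgroup.m_closed[OF sub]) (auto simp: brace_ideal_def)
  moreover have "a \<otimes>\<^bsub>B\<^esub> lambda_map B (inv\<^bsub>B\<^esub> a) b = a \<oplus>\<^bsub>B\<^esub> b"
  proof -
    have "lambda_map B a (lambda_map B (inv\<^bsub>B\<^esub> a) b) = b"
      using ab by (simp add: lambda_mult[symmetric])
    then show ?thesis using ab by (simp add: mult_eq_add_lambda)
  qed
  ultimately show ?thesis by simp
qed

lemma brace_ideal_neg_closed:
  assumes N: "brace_ideal N B" and a: "a \<in> N"
  shows "\<ominus>\<^bsub>B\<^esub> a \<in> N"
proof -
  have sub: "subgroup N B" using N normal_imp_subgroup by (auto simp: brace_ideal_def)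
  have aB: "a \<in> carrier B" using a subgroup.subset[OF sub] by auto
  have "a \<oplus>\<^bsub>B\<^esub> lambda_map B a (inv\<^bsub>B\<^esub> a) = \<zero>\<^bsub>B\<^esub>"
    using aB by (simp add: mult_eq_add_lambda[symmetric] zero_eq_one)
  then have "\<ominus>\<^bsub>B\<^esub> a = lambda_map B a (inv\<^bsub>B\<^esub> a)"
    using aB by (intro minus_equality) (auto simp: a_comm)
  also have "\<dots> \<in> N"
    using N a aB subgroup.m_inv_closed[OF sub a] by (auto simp: brace_ideal_def)
  finally show ?thesis .
qed

lemma brace_ideal_add_cancel:
  assumes N: "brace_ideal N B" and "a \<in> N" "b \<in> carrier B" "b \<oplus>\<^bsub>B\<^esub> a \<in> N"
  shows "b \<in> N"
proof -
  have "subgroup N B" using N normal_imp_subgroup by (auto simp: brace_ideal_def)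
  then have "a \<in> carrier B" using assms(2) subgroup.subset by blast
  then have "b = (b \<oplus>\<^bsub>B\<^esub> a) \<oplus>\<^bsub>B\<^esub> (\<ominus>\<^bsub>B\<^esub> a)"
    using assms(3) by (simp add: a_assoc r_neg)
  also have "\<dots> \<in> N"
    by (intro brace_ideal_add_closed[OF N] brace_ideal_neg_closed[OF N] assms(2,4))
  finally show ?thesis .
qed

end

text \<open>
  Invariance of \<open>b\<close> under both \<open>\<lambda>\<close> and the action is what the brace law of the asymmetric product
  amounts to once \<open>g \<cdot> x\<close> is written as \<open>g + \<lambda>\<^sub>g(x)\<close>.
\<close>

locale asym_product = G: left_brace G + A: abelian_group A
  for G :: "'a ring" and A :: "'b ring" +
  fixes b :: "'a \<Rightarrow> 'a \<Rightarrow> 'b" and \<alpha> :: "'b \<Rightarrow> 'a \<Rightarrow> 'a"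
  assumes b_closed [simp, intro]: "x \<in> carrier G \<Longrightarrow> y \<in> carrier G \<Longrightarrow> b x y \<in> carrier A"
    and b_sym: "x \<in> carrier G \<Longrightarrow> y \<in> carrier G \<Longrightarrow> b x y = b y x"
    and b_add: "x \<in> carrier G \<Longrightarrow> y \<in> carrier G \<Longrightarrow> z \<in> carrier G \<Longrightarrow>
      b (x \<oplus>\<^bsub>G\<^esub> y) z = b x z \<oplus>\<^bsub>A\<^esub> b y z"
    and b_lambda: "g \<in> carrier G \<Longrightarrow> x \<in> carrier G \<Longrightarrow> y \<in> carrier G \<Longrightarrow>
      b (lambda_map G g x) (lambda_map G g y) = b x y"
    and b_act: "c \<in> carrier A \<Longrightarrow> x \<in> carrier G \<Longrightarrow> y \<in> carrier G \<Longrightarrow> b (\<alpha> c x) (\<alpha> c y) = b x y"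
    and act_closed [simp, intro]: "c \<in> carrier A \<Longrightarrow> x \<in> carrier G \<Longrightarrow> \<alpha> c x \<in> carrier G"
    and act_mult: "c \<in> carrier A \<Longrightarrow> x \<in> carrier G \<Longrightarrow> y \<in> carrier G \<Longrightarrow>
      \<alpha> c (x \<otimes>\<^bsub>G\<^esub> y) = \<alpha> c x \<otimes>\<^bsub>G\<^esub> \<alpha> c y"
    and act_add: "c \<in> carrier A \<Longrightarrow> x \<in> carrier G \<Longrightarrow> y \<in> carrier G \<Longrightarrow>
      \<alpha> c (x \<oplus>\<^bsub>G\<^esub> y) = \<alpha> c x \<oplus>\<^bsub>G\<^esub> \<alpha> c y"
    and act_act: "c \<in> carrier A \<Longrightarrow> d \<in> carrier A \<Longrightarrow> x \<in> carrier G \<Longrightarrow>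
      \<alpha> (c \<oplus>\<^bsub>A\<^esub> d) x = \<alpha> c (\<alpha> d x)"
    and act_zero [simp]: "x \<in> carrier G \<Longrightarrow> \<alpha> \<zero>\<^bsub>A\<^esub> x = x"
begin

abbreviation "P \<equiv> asymmetric_product G A b \<alpha>"

lemma P_simps [simp]:
  "carrier P = carrier G \<times> carrier A"
  "(g, c) \<otimes>\<^bsub>P\<^esub> (g', c') = (g \<otimes>\<^bsub>G\<^esub> \<alpha> c g', c \<oplus>\<^bsub>A\<^esub> c')"
  "(g, c) \<oplus>\<^bsub>P\<^esub> (g', c') = (g \<oplus>\<^bsub>G\<^esub> g', c \<oplus>\<^bsub>A\<^esub> c' \<oplus>\<^bsub>A\<^esub> b g g')"
  "\<one>\<^bsub>P\<^esub> = (\<one>\<^bsub>G\<^esub>, \<zero>\<^bsub>A\<^esub>)" "\<zero>\<^bsub>P\<^esub> = (\<zero>\<^bsub>G\<^esub>, \<zero>\<^bsub>A\<^esub>)"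
  by (simp_all add: asymmetric_product_def)

lemma act_one [simp]: "c \<in> carrier A \<Longrightarrow> \<alpha> c \<one>\<^bsub>G\<^esub> = \<one>\<^bsub>G\<^esub>"
  using act_mult[of c "\<one>\<^bsub>G\<^esub>" "\<one>\<^bsub>G\<^esub>"] by (simp add: G.r_cancel_one')

lemma act_inv: "c \<in> carrier A \<Longrightarrow> x \<in> carrier G \<Longrightarrow> \<alpha> c (inv\<^bsub>G\<^esub> x) = inv\<^bsub>G\<^esub> (\<alpha> c x)"
  by (rule G.inv_equality[symmetric]) (simp_all flip: act_mult)

lemma b_add_right: "x \<in> carrier G \<Longrightarrow> y \<in> carrier G \<Longrightarrow> z \<in> carrier G \<Longrightarrow>
      b z (x \<oplus>\<^bsub>G\<^esub> y) = b z x \<oplus>\<^bsub>A\<^esub> b z y"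
  by (simp add: b_sym[of z] b_add)

lemma b_zero [simp]: "x \<in> carrier G \<Longrightarrow> b \<zero>\<^bsub>G\<^esub> x = \<zero>\<^bsub>A\<^esub>"
  using b_add[of "\<zero>\<^bsub>G\<^esub>" "\<zero>\<^bsub>G\<^esub>" x] by (simp add: A.add.r_cancel_one')

lemma b_zero_right [simp]: "x \<in> carrier G \<Longrightarrow> b x \<zero>\<^bsub>G\<^esub> = \<zero>\<^bsub>A\<^esub>"
  by (simp add: b_sym[of x])

lemma b_neg: "x \<in> carrier G \<Longrightarrow> y \<in> carrier G \<Longrightarrow> b (\<ominus>\<^bsub>G\<^esub> x) y = \<ominus>\<^bsub>A\<^esub> b x y"
  by (rule A.minus_equality[symmetric]) (simp_all flip: b_add add: G.l_neg)

lemma act_neg_cancel [simp]: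
  "c \<in> carrier A \<Longrightarrow> x \<in> carrier G \<Longrightarrow> \<alpha> (\<ominus>\<^bsub>A\<^esub> c) (\<alpha> c x) = x"
  by (simp flip: act_act add: A.l_neg)

lemma group_P: "group P"
proof (rule groupI)
  fix x assume "x \<in> carrier P"
  then obtain g c where x: "x = (g, c)" "g \<in> carrier G" "c \<in> carrier A" by auto
  then show "\<exists>y\<in>carrier P. y \<otimes>\<^bsub>P\<^esub> x = \<one>\<^bsub>P\<^esub>"
    by (intro bexI[of _ "(\<alpha> (\<ominus>\<^bsub>A\<^esub> c) (inv\<^bsub>G\<^esub> g), \<ominus>\<^bsub>A\<^esub> c)"])
      (auto simp: act_mult[symmetric] A.l_neg)
qed (auto simp: G.m_assoc A.a_assoc act_mult act_act)

lemma abelian_group_P: "abelian_group P"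
proof (rule abelian_groupI)
  fix x assume "x \<in> carrier P"
  then obtain g c where x: "x = (g, c)" "g \<in> carrier G" "c \<in> carrier A" by auto
  then show "\<exists>y\<in>carrier P. y \<oplus>\<^bsub>P\<^esub> x = \<zero>\<^bsub>P\<^esub>"
    by (intro bexI[of _ "(\<ominus>\<^bsub>G\<^esub> g, \<ominus>\<^bsub>A\<^esub> c \<oplus>\<^bsub>A\<^esub> b g g)"])
      (auto simp: b_neg G.l_neg A.l_neg A.a_ac A.r_neg A.r_neg1 A.r_neg2)
next
  fix x y assume "x \<in> carrier P" "y \<in> carrier P"
  then show "x \<oplus>\<^bsub>P\<^esub> y = y \<oplus>\<^bsub>P\<^esub> x"
    by (auto simp: G.a_comm A.a_comm b_sym)
qed (auto simp: G.a_assoc A.a_ac b_add b_add_right)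

lemma left_brace_P: "left_brace P"
proof -
  interpret PA: abelian_group P by (rule abelian_group_P)
  interpret PM: group P by (rule group_P)
  show ?thesis
  proof
    fix x y z assume "x \<in> carrier P" "y \<in> carrier P" "z \<in> carrier P"
    then obtain g c g' c' g'' c'' where x: "x = (g, c)" "g \<in> carrier G" "c \<in> carrier A"
      and y: "y = (g', c')" "g' \<in> carrier G" "c' \<in> carrier A"
      and z: "z = (g'', c'')" "g'' \<in> carrier G" "c'' \<in> carrier A" by auto
    have form: "b g' g'' \<oplus>\<^bsub>A\<^esub> b (g \<otimes>\<^bsub>G\<^esub> \<alpha> c (g' \<oplus>\<^bsub>G\<^esub> g'')) g = b (g \<otimes>\<^bsub>G\<^esub> \<alpha> c g') (g \<otimes>\<^bsub>G\<^esub> \<alpha> c g'')"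
    proof -
      have "b (g \<otimes>\<^bsub>G\<^esub> \<alpha> c g') (g \<otimes>\<^bsub>G\<^esub> \<alpha> c g'') = b g g \<oplus>\<^bsub>A\<^esub> b g (lambda_map G g (\<alpha> c g''))
        \<oplus>\<^bsub>A\<^esub> (b (lambda_map G g (\<alpha> c g')) g \<oplus>\<^bsub>A\<^esub> b g' g'')"
        using x y z
        by (simp add: G.mult_eq_add_lambda b_add b_add_right b_lambda b_act A.a_ac)
      moreover have "b (g \<otimes>\<^bsub>G\<^esub> \<alpha> c (g' \<oplus>\<^bsub>G\<^esub> g'')) g = b g g \<oplus>\<^bsub>A\<^esub>
        (b (lambda_map G g (\<alpha> c g')) g \<oplus>\<^bsub>A\<^esub> b (lambda_map G g (\<alpha> c g'')) g)"
        using x y z by (simp add: G.mult_eq_add_lambda G.lambda_add act_add b_add)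
      ultimately show ?thesis
        using x y z by (simp add: A.a_ac b_sym[of g "lambda_map G g (\<alpha> c g'')"])
    qed
    have "g \<otimes>\<^bsub>G\<^esub> \<alpha> c (g' \<oplus>\<^bsub>G\<^esub> g'') \<oplus>\<^bsub>G\<^esub> g = g \<otimes>\<^bsub>G\<^esub> \<alpha> c g' \<oplus>\<^bsub>G\<^esub> g \<otimes>\<^bsub>G\<^esub> \<alpha> c g''"
      using x y z by (simp add: act_add G.brace_law)
    then show "x \<otimes>\<^bsub>P\<^esub> (y \<oplus>\<^bsub>P\<^esub> z) \<oplus>\<^bsub>P\<^esub> x = x \<otimes>\<^bsub>P\<^esub> y \<oplus>\<^bsub>P\<^esub> x \<otimes>\<^bsub>P\<^esub> z"
      using x y z by (simp add: form[symmetric] A.a_ac)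
  qed
qed

interpretation P: left_brace P by (rule left_brace_P)

text \<open>
  When \<open>\<lambda>\<^sub>x\<close> and the action of \<open>d\<close> fix \<open>g\<close>, only the second component moves, and it moves by a value
  of the form.  This is how an ideal reaches the second factor.
\<close>

lemma lambda_P:
  assumes "x \<in> carrier G" "d \<in> carrier A" "g \<in> carrier G" "c \<in> carrier A"
  shows "lambda_map P (x, d) (g, c) =
    (lambda_map G x (\<alpha> d g), c \<ominus>\<^bsub>A\<^esub> b (lambda_map G x (\<alpha> d g)) x)"
  using assms
  by (intro P.lambda_eqI)
    (auto simp: G.mult_eq_add_lambda b_sym[of x] a_minus_def A.a_assoc A.l_neg)

lemma inv_P_left: "g \<in> carrier G \<Longrightarrow> inv\<^bsub>P\<^esub> (g, \<zero>\<^bsub>A\<^esub>) = (inv\<^bsub>G\<^esub> g, \<zero>\<^bsub>A\<^esub>)"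
  by (rule P.inv_equality) auto

lemma inv_P_right: "c \<in> carrier A \<Longrightarrow> inv\<^bsub>P\<^esub> (\<one>\<^bsub>G\<^esub>, c) = (\<one>\<^bsub>G\<^esub>, \<ominus>\<^bsub>A\<^esub> c)"
  by (rule P.inv_equality) (auto simp: A.l_neg)

lemma conjugate_P:
  assumes "h \<in> carrier G" "g \<in> carrier G" "c \<in> carrier A"
  shows "(h, \<zero>\<^bsub>A\<^esub>) \<otimes>\<^bsub>P\<^esub> (g, c) \<otimes>\<^bsub>P\<^esub> inv\<^bsub>P\<^esub> (h, \<zero>\<^bsub>A\<^esub>) = (h \<otimes>\<^bsub>G\<^esub> g \<otimes>\<^bsub>G\<^esub> \<alpha> c (inv\<^bsub>G\<^esub> h), c)"
  using assms by (simp add: inv_P_left)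

lemma commutator_P:
  assumes "x \<in> carrier G" "c \<in> carrier A"
  shows "(x, \<zero>\<^bsub>A\<^esub>) \<otimes>\<^bsub>P\<^esub> (\<one>\<^bsub>G\<^esub>, c) \<otimes>\<^bsub>P\<^esub> inv\<^bsub>P\<^esub> (x, \<zero>\<^bsub>A\<^esub>) \<otimes>\<^bsub>P\<^esub> inv\<^bsub>P\<^esub> (\<one>\<^bsub>G\<^esub>, c) =
    (x \<otimes>\<^bsub>G\<^esub> inv\<^bsub>G\<^esub> (\<alpha> c x), \<zero>\<^bsub>A\<^esub>)"
  using assms by (simp add: inv_P_left inv_P_right A.r_neg act_inv)

lemma left_hom: "(\<lambda>g. (g, \<zero>\<^bsub>A\<^esub>)) \<in> hom G P"
  by (auto simp: hom_def)

lemma normal_left_part: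
  assumes "N \<lhd> P"
  shows "{g \<in> carrier G. (g, \<zero>\<^bsub>A\<^esub>) \<in> N} \<lhd> G"
  unfolding G.normal_inv_iff
proof (intro conjI ballI)
  have sub: "subgroup N P" using assms by (rule normal_imp_subgroup)
  show "subgroup {g \<in> carrier G. (g, \<zero>\<^bsub>A\<^esub>) \<in> N} G"
    using subgroup.one_closed[OF sub] subgroup.m_closed[OF sub] subgroup.m_inv_closed[OF sub]
    by (unfold_locales) (force simp: inv_P_left[symmetric])+
next
  fix x h assume x: "x \<in> carrier G" and h: "h \<in> {g \<in> carrier G. (g, \<zero>\<^bsub>A\<^esub>) \<in> N}"
  then have "(x, \<zero>\<^bsub>A\<^esub>) \<otimes>\<^bsub>P\<^esub> (h, \<zero>\<^bsub>A\<^esub>) \<otimes>\<^bsub>P\<^esub> inv\<^bsub>P\<^esub> (x, \<zero>\<^bsub>A\<^esub>) \<in> N"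
    by (intro normal.inv_op_closed2[OF assms]) auto
  then show "x \<otimes>\<^bsub>G\<^esub> h \<otimes>\<^bsub>G\<^esub> inv\<^bsub>G\<^esub> x \<in> {g \<in> carrier G. (g, \<zero>\<^bsub>A\<^esub>) \<in> N}"
    using x h by (simp add: inv_P_left)
qed

text \<open>
  An ideal \<open>N \<noteq> 0\<close> is enlarged in four moves: \<open>detect\<close> produces \<open>(u, d) \<in> N\<close> with \<open>b(u, x) \<noteq> 0\<close> for some
  \<open>x\<close> with \<open>\<lambda>\<^sub>x(u) = u\<close>; the map \<open>\<lambda>\<close> of \<open>(x, 0)\<close> then gives \<open>(0, b(u, x)) \<in> N\<close>; by \<open>perfect\<close> the commutators with
  this element fill the first factor; and sums of elements of the first factor bring in all
  values of the form, one of which generates the second factor by \<open>generic\<close>.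
\<close>

lemma simple_P:
  assumes detect: "\<And>g c. g \<in> carrier G \<Longrightarrow> c \<in> carrier A \<Longrightarrow> (g, c) \<noteq> (\<one>\<^bsub>G\<^esub>, \<zero>\<^bsub>A\<^esub>) \<Longrightarrow>
      \<exists>u\<in>carrier G. \<exists>x\<in>carrier G. lambda_map G x u = u \<and> b u x \<noteq> \<zero>\<^bsub>A\<^esub> \<and>
        (u = g \<or> (\<exists>h\<in>carrier G. h \<otimes>\<^bsub>G\<^esub> g \<otimes>\<^bsub>G\<^esub> \<alpha> c (inv\<^bsub>G\<^esub> h) = u \<oplus>\<^bsub>G\<^esub> g))"
    and perfect: "\<And>c M. c \<in> carrier A \<Longrightarrow> c \<noteq> \<zero>\<^bsub>A\<^esub> \<Longrightarrow> M \<lhd> G \<Longrightarrow>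
      (\<And>x. x \<in> carrier G \<Longrightarrow> x \<otimes>\<^bsub>G\<^esub> inv\<^bsub>G\<^esub> (\<alpha> c x) \<in> M) \<Longrightarrow> M = carrier G"
    and generic: "\<exists>g\<in>carrier G. \<exists>g'\<in>carrier G. \<forall>S. subgroup S (add_monoid A) \<longrightarrow> b g g' \<in> S \<longrightarrow> S = carrier A"
    and nontrivial: "carrier A \<noteq> {\<zero>\<^bsub>A\<^esub>}"
  shows "simple_left_brace P"
  unfolding simple_left_brace_def
proof (intro conjI allI impI left_brace_P)
  show "carrier P \<noteq> {\<zero>\<^bsub>P\<^esub>}"
    using nontrivial A.zero_closed G.zero_closed by auto
  fix N assume N: "brace_ideal N P"
  then have normal: "N \<lhd> P" and lam: "\<And>x y. x \<in> carrier P \<Longrightarrow> y \<in> N \<Longrightarrow> lambda_map P x y \<in> N"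
    by (auto simp: brace_ideal_def)
  have sub: "subgroup N P" using normal by (rule normal_imp_subgroup)
  show "N = {\<zero>\<^bsub>P\<^esub>} \<or> N = carrier P"
  proof (cases "N = {\<zero>\<^bsub>P\<^esub>}")
    case False
    then obtain g c where gc: "(g, c) \<in> N" "(g, c) \<noteq> (\<one>\<^bsub>G\<^esub>, \<zero>\<^bsub>A\<^esub>)"
      using subgroup.one_closed[OF sub] G.zero_eq_one by auto
    then have g: "g \<in> carrier G" and c: "c \<in> carrier A" using subgroup.subset[OF sub] by auto
    obtain u x where u: "u \<in> carrier G" and x: "x \<in> carrier G" "lambda_map G x u = u"
      and ux: "b u x \<noteq> \<zero>\<^bsub>A\<^esub>"
      and ug: "u = g \<or> (\<exists>h\<in>carrier G. h \<otimes>\<^bsub>G\<^esub> g \<otimes>\<^bsub>G\<^esub> \<alpha> c (inv\<^bsub>G\<^esub> h) = u \<oplus>\<^bsub>G\<^esub> g)"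
      using detect[OF g c gc(2)] by auto
    have "\<exists>d\<in>carrier A. (u, d) \<in> N"
      using ug
    proof
      assume "\<exists>h\<in>carrier G. h \<otimes>\<^bsub>G\<^esub> g \<otimes>\<^bsub>G\<^esub> \<alpha> c (inv\<^bsub>G\<^esub> h) = u \<oplus>\<^bsub>G\<^esub> g"
      then obtain h where h: "h \<in> carrier G" "h \<otimes>\<^bsub>G\<^esub> g \<otimes>\<^bsub>G\<^esub> \<alpha> c (inv\<^bsub>G\<^esub> h) = u \<oplus>\<^bsub>G\<^esub> g" by auto
      have "(u, \<ominus>\<^bsub>A\<^esub> b u g) \<oplus>\<^bsub>P\<^esub> (g, c) = (h, \<zero>\<^bsub>A\<^esub>) \<otimes>\<^bsub>P\<^esub> (g, c) \<otimes>\<^bsub>P\<^esub> inv\<^bsub>P\<^esub> (h, \<zero>\<^bsub>A\<^esub>)"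
        unfolding conjugate_P[OF h(1) g c] h(2) using u g c
        by (simp add: A.a_ac A.r_neg A.r_neg1)
      also have "\<dots> \<in> N"
        using gc(1) h(1) by (intro normal.inv_op_closed2[OF normal]) auto
      finally have "(u, \<ominus>\<^bsub>A\<^esub> b u g) \<oplus>\<^bsub>P\<^esub> (g, c) \<in> N" .
      then have "(u, \<ominus>\<^bsub>A\<^esub> b u g) \<in> N"
        by (rule P.brace_ideal_add_cancel[OF N gc(1), rotated]) (use u g in simp)
      then show ?thesis using u g by auto
    qed (use gc(1) c in auto)
    then obtain d where d: "d \<in> carrier A" "(u, d) \<in> N" by auto
    \<comment> \<open>Comparing \<open>(u, d)\<close> with its image under \<open>\<lambda>\<close> of \<open>(x, 0)\<close> isolates the value of the form.\<close>
    have in_A: "(\<one>\<^bsub>G\<^esub>, b u x) \<in> N"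
    proof (rule P.brace_ideal_add_cancel[OF N])
      have "lambda_map P (x, \<zero>\<^bsub>A\<^esub>) (u, d) \<in> N"
        using d x(1) by (intro lam) auto
      then show "(u, d \<ominus>\<^bsub>A\<^esub> b u x) \<in> N"
        using u x d(1) by (simp add: lambda_P)
      show "(\<one>\<^bsub>G\<^esub>, b u x) \<oplus>\<^bsub>P\<^esub> (u, d \<ominus>\<^bsub>A\<^esub> b u x) \<in> N"
        using u x d by (simp add: G.zero_eq_one[symmetric] a_minus_def A.a_ac A.r_neg A.r_neg1 A.r_neg2)
    qed (use u x in auto)
    have "{g \<in> carrier G. (g, \<zero>\<^bsub>A\<^esub>) \<in> N} = carrier G"
    proof (rule perfect[OF _ ux normal_left_part[OF normal]])
      fix y assume y: "y \<in> carrier G"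
      have "(y, \<zero>\<^bsub>A\<^esub>) \<otimes>\<^bsub>P\<^esub> (\<one>\<^bsub>G\<^esub>, b u x) \<otimes>\<^bsub>P\<^esub> inv\<^bsub>P\<^esub> (y, \<zero>\<^bsub>A\<^esub>) \<in> N"
        using y in_A by (intro normal.inv_op_closed2[OF normal]) auto
      from subgroup.m_closed[OF sub this subgroup.m_inv_closed[OF sub in_A]]
      have "(y \<otimes>\<^bsub>G\<^esub> inv\<^bsub>G\<^esub> (\<alpha> (b u x) y), \<zero>\<^bsub>A\<^esub>) \<in> N"
        using y u x by (simp only: commutator_P b_closed)
      then show "y \<otimes>\<^bsub>G\<^esub> inv\<^bsub>G\<^esub> (\<alpha> (b u x) y) \<in> {g \<in> carrier G. (g, \<zero>\<^bsub>A\<^esub>) \<in> N}"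
        using y u x by auto
    qed (use u x in auto)
    then have left: "(g, \<zero>\<^bsub>A\<^esub>) \<in> N" if "g \<in> carrier G" for g using that by auto
    have forms: "(\<one>\<^bsub>G\<^esub>, b g g') \<in> N" if g: "g \<in> carrier G" and g': "g' \<in> carrier G" for g g'
    proof (rule P.brace_ideal_add_cancel[OF N left])
      have "(\<one>\<^bsub>G\<^esub>, b g g') \<oplus>\<^bsub>P\<^esub> (g \<oplus>\<^bsub>G\<^esub> g', \<zero>\<^bsub>A\<^esub>) = (g, \<zero>\<^bsub>A\<^esub>) \<oplus>\<^bsub>P\<^esub> (g', \<zero>\<^bsub>A\<^esub>)"
        using g g' by (simp add: G.zero_eq_one[symmetric])
      then show "(\<one>\<^bsub>G\<^esub>, b g g') \<oplus>\<^bsub>P\<^esub> (g \<oplus>\<^bsub>G\<^esub> g', \<zero>\<^bsub>A\<^esub>) \<in> N"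
        using P.brace_ideal_add_closed[OF N left[OF g] left[OF g']] by simp
    qed (use g g' in auto)
    have "subgroup {c \<in> carrier A. (\<one>\<^bsub>G\<^esub>, c) \<in> N} (add_monoid A)"
    proof (rule A.a_group[THEN group.subgroupI])
      show "{c \<in> carrier A. (\<one>\<^bsub>G\<^esub>, c) \<in> N} \<noteq> {}"
        using subgroup.one_closed[OF sub] by auto
      fix c c' assume cc: "c \<in> {c \<in> carrier A. (\<one>\<^bsub>G\<^esub>, c) \<in> N}"
      then show "inv\<^bsub>add_monoid A\<^esub> c \<in> {c \<in> carrier A. (\<one>\<^bsub>G\<^esub>, c) \<in> N}"
        unfolding a_inv_def[symmetric]
        using subgroup.m_inv_closed[OF sub, of "(\<one>\<^bsub>G\<^esub>, c)"] by (auto simp: inv_P_right)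
      assume "c' \<in> {c \<in> carrier A. (\<one>\<^bsub>G\<^esub>, c) \<in> N}"
      then show "c \<otimes>\<^bsub>add_monoid A\<^esub> c' \<in> {c \<in> carrier A. (\<one>\<^bsub>G\<^esub>, c) \<in> N}"
        using cc subgroup.m_closed[OF sub, of "(\<one>\<^bsub>G\<^esub>, c)" "(\<one>\<^bsub>G\<^esub>, c')"] by auto
    qed auto
    moreover obtain e e' where "e \<in> carrier G" "e' \<in> carrier G"
      "\<And>S. subgroup S (add_monoid A) \<Longrightarrow> b e e' \<in> S \<Longrightarrow> S = carrier A"
      using generic by blast
    ultimately have "{c \<in> carrier A. (\<one>\<^bsub>G\<^esub>, c) \<in> N} = carrier A"
      using forms by auto
    then have right: "(\<one>\<^bsub>G\<^esub>, c) \<in> N" if "c \<in> carrier A" for c using that by auto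
    have "(g, c) \<in> N" if "g \<in> carrier G" "c \<in> carrier A" for g c
      using subgroup.m_closed[OF sub left[OF that(1)] right[OF that(2)]] that by simp
    then show ?thesis using subgroup.subset[OF sub] by auto
  qed simp
qed

text \<open>
  The quotient by the first factor is abelian, and the first factor is normally generated by its
  commutators with a single element \<open>c\<close> of the second.
\<close>

lemma derived_P:
  assumes perfect: "\<And>M. M \<lhd> G \<Longrightarrow> (\<And>x. x \<in> carrier G \<Longrightarrow> x \<otimes>\<^bsub>G\<^esub> inv\<^bsub>G\<^esub> (\<alpha> c x) \<in> M) \<Longrightarrow> M = carrier G"
    and c: "c \<in> carrier A"
  shows "(derived P ^^ Suc d) (carrier P) = (\<lambda>g. (g, \<zero>\<^bsub>A\<^esub>)) ` ((derived G ^^ d) (carrier G))"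
proof -
  interpret L: group_hom G P "\<lambda>g. (g, \<zero>\<^bsub>A\<^esub>)"
    using left_hom by unfold_locales
  have "derived P (carrier P) = (\<lambda>g. (g, \<zero>\<^bsub>A\<^esub>)) ` carrier G"
  proof
    have "subgroup ((\<lambda>g. (g, \<zero>\<^bsub>A\<^esub>)) ` carrier G) P" by (rule L.img_is_subgroup)
    moreover have "derived_set P (carrier P) \<subseteq> (\<lambda>g. (g, \<zero>\<^bsub>A\<^esub>)) ` carrier G"
    proof -
      have S: "(\<lambda>x. snd x) \<in> hom P (add_monoid A)" by (auto simp: hom_def)
      interpret S: group_hom P "add_monoid A" snd
        using S A.a_group by (intro group_hom.intro group_hom_axioms.intro) (auto intro: group_P)
      have "snd (x \<otimes>\<^bsub>P\<^esub> y \<otimes>\<^bsub>P\<^esub> inv\<^bsub>P\<^esub> x \<otimes>\<^bsub>P\<^esub> inv\<^bsub>P\<^esub> y) = \<zero>\<^bsub>A\<^esub>"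
        if "x \<in> carrier P" "y \<in> carrier P" for x y
      proof -
        have "snd (x \<otimes>\<^bsub>P\<^esub> y \<otimes>\<^bsub>P\<^esub> inv\<^bsub>P\<^esub> x \<otimes>\<^bsub>P\<^esub> inv\<^bsub>P\<^esub> y) =
          snd x \<oplus>\<^bsub>A\<^esub> snd y \<oplus>\<^bsub>A\<^esub> \<ominus>\<^bsub>A\<^esub> snd x \<oplus>\<^bsub>A\<^esub> \<ominus>\<^bsub>A\<^esub> snd y"
          using that by (simp only: S.hom_mult S.hom_inv P.m_closed P.inv_closed monoid.simps a_inv_def)
        also have "\<dots> = \<zero>\<^bsub>A\<^esub>"
          using that A.r_neg[of "snd x \<oplus>\<^bsub>A\<^esub> snd y"] by (auto simp: A.minus_add A.a_assoc)
        finally show ?thesis .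
      qed
      moreover have "z \<in> (\<lambda>g. (g, \<zero>\<^bsub>A\<^esub>)) ` carrier G" if "z \<in> carrier P" "snd z = \<zero>\<^bsub>A\<^esub>" for z
        using that by (cases z) auto
      ultimately have "x \<otimes>\<^bsub>P\<^esub> y \<otimes>\<^bsub>P\<^esub> inv\<^bsub>P\<^esub> x \<otimes>\<^bsub>P\<^esub> inv\<^bsub>P\<^esub> y \<in> (\<lambda>g. (g, \<zero>\<^bsub>A\<^esub>)) ` carrier G"
        if "x \<in> carrier P" "y \<in> carrier P" for x y
        using that P.m_closed P.inv_closed by presburger
      then show ?thesis by blast
    qed
    ultimately show "derived P (carrier P) \<subseteq> (\<lambda>g. (g, \<zero>\<^bsub>A\<^esub>)) ` carrier G"
      unfolding derived_def by (rule P.generate_subgroup_incl[rotated])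
  next
    have "{g \<in> carrier G. (g, \<zero>\<^bsub>A\<^esub>) \<in> derived P (carrier P)} = carrier G"
    proof (rule perfect[OF normal_left_part[OF P.derived_self_is_normal]])
      fix x assume x: "x \<in> carrier G"
      have "(x, \<zero>\<^bsub>A\<^esub>) \<otimes>\<^bsub>P\<^esub> (\<one>\<^bsub>G\<^esub>, c) \<otimes>\<^bsub>P\<^esub> inv\<^bsub>P\<^esub> (x, \<zero>\<^bsub>A\<^esub>) \<otimes>\<^bsub>P\<^esub> inv\<^bsub>P\<^esub> (\<one>\<^bsub>G\<^esub>, c) \<in> derived P (carrier P)"
        by (rule commutator_in_derived) (use x c in simp_all)
      then show "x \<otimes>\<^bsub>G\<^esub> inv\<^bsub>G\<^esub> (\<alpha> c x) \<in> {g \<in> carrier G. (g, \<zero>\<^bsub>A\<^esub>) \<in> derived P (carrier P)}"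
        using x c by (simp only: commutator_P mem_Collect_eq G.m_closed G.inv_closed act_closed simp_thms)
    qed
    then show "(\<lambda>g. (g, \<zero>\<^bsub>A\<^esub>)) ` carrier G \<subseteq> derived P (carrier P)" by auto
  qed
  then have "(derived P ^^ Suc d) (carrier P) = (derived P ^^ d) ((\<lambda>g. (g, \<zero>\<^bsub>A\<^esub>)) ` carrier G)"
    by (simp add: funpow_swap1)
  also have "\<dots> = (\<lambda>g. (g, \<zero>\<^bsub>A\<^esub>)) ` ((derived G ^^ d) (carrier G))"
    by (rule L.exp_of_derived_img) simp
  finally show ?thesis .
qed

end

section \<open>Derived length from two consecutive terms\<close>

lemma derived_length_eqI:
  assumes "group G" "(derived G ^^ Suc d) (carrier G) = {\<one>\<^bsub>G\<^esub>}" "(derived G ^^ d) (carrier G) \<noteq> {\<one>\<^bsub>G\<^esub>}"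
  shows "derived_length G = enat (Suc d)"
proof -
  interpret group G by fact
  have sub: "subgroup ((derived G ^^ e) (carrier G)) G" for e
    by (rule exp_of_derived_is_subgroup[OF subgroup_self])
  have "Suc d \<le> e" if e: "(derived G ^^ e) (carrier G) = {\<one>\<^bsub>G\<^esub>}" for e
  proof (rule ccontr)
    assume "\<not> Suc d \<le> e"
    then obtain k where k: "d = k + e" by (metis add.commute le_Suc_ex not_less_eq_eq)
    have "(derived G ^^ k) {\<one>\<^bsub>G\<^esub>} \<subseteq> {\<one>\<^bsub>G\<^esub>}" for k
    proof (induction k)
      case (Suc k)
      then show ?case using derived_incl[OF Suc triv_subgroup] by simp
    qed simp
    then have "(derived G ^^ d) (carrier G) \<subseteq> {\<one>\<^bsub>G\<^esub>}"
      unfolding k funpow_add o_def e .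
    then show False using assms(3) subgroup.one_closed[OF sub[of d]] by auto
  qed
  then show ?thesis
    unfolding derived_length_def using assms(2) by (intro antisym INF_lower INF_greatest) auto
qed


section \<open>The tower\<close>

lemma left_brace_trivial_brace:
  assumes "comm_group M"
  shows "left_brace (trivial_brace M)"
proof -
  interpret M: comm_group M by fact
  interpret PA: abelian_group "trivial_brace M"
    by (rule abelian_groupI) (auto simp: trivial_brace_def M.m_ac intro: M.l_inv_ex)
  interpret PM: group "trivial_brace M"
    by (rule groupI) (auto simp: trivial_brace_def M.m_ac intro: M.l_inv_ex)
  show ?thesis
    by unfold_locales (auto simp: trivial_brace_def M.m_ac)
qed

lemma comm_group_Fp:
  assumes "q > 1"
  shows "comm_group (add_monoid (Fp q))"
proof -
  interpret R: residues "int q" "Fp q"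
    using assms by unfold_locales (simp_all add: Fp_def)
  show ?thesis by (rule R.a_comm_group)
qed

locale simple_tower =
  fixes n :: nat and p :: "nat \<Rightarrow> nat" and \<gamma> :: int
  assumes n_ge_2: "n \<ge> 2"
    and prime_p: "\<And>i. i \<in> {1..n} \<Longrightarrow> Factorial_Ring.prime (p i)"
    and inj_p: "inj_on p {1..n}"
    and dvd_p: "\<And>i j. j \<in> {2..n} \<Longrightarrow> i \<in> {1..<j} \<Longrightarrow> p j dvd p i - 1"
    and \<gamma>_closed: "\<gamma> \<in> carrier (mult_of (Fp (p 1)))"
    and \<gamma>_order: "group.ord (mult_of (Fp (p 1))) \<gamma> = (\<Prod>j\<in>{2..n}. p j)"
begin

abbreviation "L m \<equiv> Gbar p m"
abbreviation "C m \<equiv> carrier (Gbar p m)"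
abbreviation "N \<equiv> \<Prod>j\<in>{2..n}. p j"
abbreviation "\<alpha> \<equiv> act p \<gamma>"

definition power_\<gamma> :: "int \<Rightarrow> int" where
  "power_\<gamma> i = \<gamma> [^]\<^bsub>mult_of (Fp (p 1))\<^esub> i"

lemma p_gt_1: "i \<in> {1..n} \<Longrightarrow> p i > 1"
  using prime_p prime_gt_1_nat by blast

lemma p_cong_1: "j \<in> {2..n} \<Longrightarrow> i \<in> {1..<j} \<Longrightarrow> [int (p i) = 1] (mod int (p j))"
proof -
  assume ij: "j \<in> {2..n}" "i \<in> {1..<j}"
  then have "p i > 1" by (intro p_gt_1) auto
  moreover have "int (p j) dvd int (p i - 1)" using dvd_p[OF ij] by simp
  ultimately show ?thesis by (simp add: cong_iff_dvd_diff of_nat_diff)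
qed

lemma power_\<gamma>_facts:
  "0 < power_\<gamma> i" "power_\<gamma> i < int (p 1)" "power_\<gamma> 0 = 1"
  "power_\<gamma> (i + k) = (power_\<gamma> i * power_\<gamma> k) mod int (p 1)"
  "power_\<gamma> i = power_\<gamma> k \<longleftrightarrow> int N dvd (k - i)"
proof -
  interpret R: residues_prime "p 1" "Fp (p 1)"
    using n_ge_2 prime_p[of 1] by unfold_locales (simp_all add: Fp_def)
  interpret U: group "mult_of (Fp (p 1))"
    by (rule field.field_mult_group[OF R.is_field])
  have "power_\<gamma> i \<in> carrier (mult_of (Fp (p 1)))"
    unfolding power_\<gamma>_def using \<gamma>_closed by (rule U.int_pow_closed)
  then show "0 < power_\<gamma> i" "power_\<gamma> i < int (p 1)" by (auto simp: Fp_simps)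
  show "power_\<gamma> 0 = 1" by (simp add: power_\<gamma>_def Fp_simps)
  show "power_\<gamma> (i + k) = (power_\<gamma> i * power_\<gamma> k) mod int (p 1)"
    unfolding power_\<gamma>_def U.int_pow_mult[OF \<gamma>_closed] by (simp add: Fp_simps)
  show "power_\<gamma> i = power_\<gamma> k \<longleftrightarrow> int N dvd (k - i)"
    unfolding power_\<gamma>_def U.int_pow_eq[OF \<gamma>_closed] \<gamma>_order ..
qed

lemma L_1: "L 1 = trivial_brace (add_monoid (Fp (p 1)))"
  by simp

lemma L_1_simps:
  "C 1 = {0..<int (p 1)}" "x \<otimes>\<^bsub>L 1\<^esub> y = (x + y) mod int (p 1)"
  "x \<oplus>\<^bsub>L 1\<^esub> y = (x + y) mod int (p 1)" "\<one>\<^bsub>L 1\<^esub> = 0" "\<zero>\<^bsub>L 1\<^esub> = 0"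
  by (simp_all add: trivial_brace_def Fp_simps)

lemma act_1: "\<alpha> 1 i x = (power_\<gamma> i * x) mod int (p 1)"
  by (simp add: power_\<gamma>_def Fp_simps)

lemma L_Suc: "m \<ge> 1 \<Longrightarrow> L (Suc m) = relabel (wreath_quot (L m) (Fp (p (Suc m))))"
  by (cases m) auto

lemma level_Suc: "level p (Suc m) = carrier (wreath_quot (L m) (Fp (p (Suc m))))"
  by (simp add: level_def)

lemma act_Suc: "m \<ge> 1 \<Longrightarrow> \<alpha> (Suc m) i x =
    enc (level p (Suc m)) (wreath_quot_map (L m) (\<alpha> m i) (dec (level p (Suc m)) x))"
  by (cases m) auto

declare Gbar.simps [simp del] act.simps [simp del] One_nat_def [simp del]

lemma left_brace_L_1: "left_brace (L 1)"
  unfolding L_1 using n_ge_2 p_gt_1[of 1] by (intro left_brace_trivial_brace comm_group_Fp) auto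

text \<open>
  The congruences are kept for all later primes, since the step from \<open>m\<close> to \<open>m + 1\<close> uses the one
  for \<open>p (m + 1)\<close> and has to pass on the others.
\<close>

lemma levels:
  assumes "1 \<le> m" "m \<le> n"
  shows "left_brace (L m) \<and> finite (C m) \<and> card (C m) > 2 \<and>
    (\<forall>j\<in>{m<..n}. [int (card (C m)) = 1] (mod int (p j)))"
  using assms
proof (induction m rule: nat_induct_at_least)
  case base
  have "p 2 dvd p 1 - 1" "p 1 > 1" "p 2 > 1"
    using n_ge_2 by (auto intro!: dvd_p p_gt_1)
  \<comment> \<open>Hence \<open>p 1 \<ge> 3\<close>, which is the bound on the number of points.\<close>
  then have "p 2 \<le> p 1 - 1" by (intro dvd_imp_le) auto
  with \<open>p 2 > 1\<close> show ?case
    using left_brace_L_1 p_cong_1[of _ 1] unfolding L_1_simps by auto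
next
  case (Suc m)
  interpret S: wreath_step "L m" "p (Suc m)"
    using Suc prime_p[of "Suc m"] by (auto simp: wreath_step_def wreath_step_axioms_def)
  have "[int (card (C (Suc m))) = 1] (mod int (p j))" if "j \<in> {Suc m<..n}" for j
    unfolding L_Suc[OF Suc.hyps] using Suc that p_cong_1[of j "Suc m"] by (intro S.card_Q_cong_1) auto
  then show ?case
    using S.left_brace_Q S.finite_Q S.card_Q_gt_2 by (auto simp: L_Suc[OF Suc.hyps])
qed

lemma step: "1 \<le> m \<Longrightarrow> m < n \<Longrightarrow> wreath_step (L m) (p (Suc m))"
  using levels[of m] prime_p[of "Suc m"] by (auto simp: wreath_step_def wreath_step_axioms_def)

text \<open>
  The action properties of the level below appear as premises because this formula is the
  induction step in the proof of those same properties.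
\<close>

lemma act_mk_of_action:
  assumes m: "1 \<le> m" "m < n" and g: "g \<in> C m"
    and closed: "\<And>i x. x \<in> C m \<Longrightarrow> \<alpha> m i x \<in> C m" and zero: "\<And>x. x \<in> C m \<Longrightarrow> \<alpha> m 0 x = x"
    and add: "\<And>i k x. x \<in> C m \<Longrightarrow> \<alpha> m (i + k) x = \<alpha> m i (\<alpha> m k x)"
  shows "\<alpha> (Suc m) i (wreath_step.mk (L m) (p (Suc m)) h g) =
    wreath_step.mk (L m) (p (Suc m)) (\<lambda>x. h (\<alpha> m (- i) x)) (\<alpha> m i g)"
proof -
  interpret S: wreath_step "L m" "p (Suc m)" using m by (rule step)
  have inv: "\<alpha> m i (\<alpha> m (- i) x) = x" "\<alpha> m (- i) (\<alpha> m i x) = x" if "x \<in> C m" for x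
    using that by (simp_all flip: add add: zero)
  have "bij_betw (\<alpha> m i) (C m) (C m)"
    by (rule bij_betw_byWitness[of _ "\<alpha> m (- i)"]) (use inv closed in auto)
  then have "wreath_quot_map (L m) (\<alpha> m i) (S.fcoset h \<times> {g}) =
      S.fcoset (\<lambda>x. h (\<alpha> m (- i) x)) \<times> {\<alpha> m i g}"
    using inv closed g by (intro S.wreath_quot_map_fcoset) auto
  then show ?thesis
    using g m(1) by (simp add: act_Suc level_Suc) (simp add: S.mk_def)
qed

lemma act_facts:
  assumes "1 \<le> m" "m \<le> n"
  shows "(\<forall>i. \<forall>x\<in>C m. \<alpha> m i x \<in> C m) \<and> (\<forall>x\<in>C m. \<alpha> m 0 x = x) \<and>
    (\<forall>i k. \<forall>x\<in>C m. \<alpha> m (i + k) x = \<alpha> m i (\<alpha> m k x)) \<and>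
    (\<forall>i. \<forall>x\<in>C m. \<forall>y\<in>C m. \<alpha> m i (x \<otimes>\<^bsub>L m\<^esub> y) = \<alpha> m i x \<otimes>\<^bsub>L m\<^esub> \<alpha> m i y) \<and>
    (\<forall>i. \<forall>x\<in>C m. \<forall>y\<in>C m. \<alpha> m i (x \<oplus>\<^bsub>L m\<^esub> y) = \<alpha> m i x \<oplus>\<^bsub>L m\<^esub> \<alpha> m i y)"
  using assms
proof (induction m rule: nat_induct_at_least)
  case base
  have "p 1 > 1" using n_ge_2 by (auto intro!: p_gt_1)
  then show ?case
    unfolding L_1_simps act_1
    by (auto simp: power_\<gamma>_facts mod_simps algebra_simps)
next
  case (Suc m)
  interpret S: wreath_step "L m" "p (Suc m)" using Suc by (intro step) auto
  have IH: "\<And>i x. x \<in> C m \<Longrightarrow> \<alpha> m i x \<in> C m" "\<And>x. x \<in> C m \<Longrightarrow> \<alpha> m 0 x = x"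
    "\<And>i k x. x \<in> C m \<Longrightarrow> \<alpha> m (i + k) x = \<alpha> m i (\<alpha> m k x)"
    "\<And>i x y. x \<in> C m \<Longrightarrow> y \<in> C m \<Longrightarrow> \<alpha> m i (x \<otimes>\<^bsub>L m\<^esub> y) = \<alpha> m i x \<otimes>\<^bsub>L m\<^esub> \<alpha> m i y"
    "\<And>i x y. x \<in> C m \<Longrightarrow> y \<in> C m \<Longrightarrow> \<alpha> m i (x \<oplus>\<^bsub>L m\<^esub> y) = \<alpha> m i x \<oplus>\<^bsub>L m\<^esub> \<alpha> m i y"
    using Suc by auto
  have mk: "\<alpha> (Suc m) i (S.mk h g) = S.mk (\<lambda>x. h (\<alpha> m (- i) x)) (\<alpha> m i g)" if "g \<in> C m" for i h g
    using Suc that IH by (intro act_mk_of_action) auto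
  have one: "\<alpha> m i \<one>\<^bsub>L m\<^esub> = \<one>\<^bsub>L m\<^esub>" for i
    using IH(4)[of "\<one>\<^bsub>L m\<^esub>" "\<one>\<^bsub>L m\<^esub>" i] IH(1)[of "\<one>\<^bsub>L m\<^esub>" i] by (simp add: S.r_cancel_one')
  have inv: "\<alpha> m i (inv\<^bsub>L m\<^esub> x) = inv\<^bsub>L m\<^esub> (\<alpha> m i x)" if "x \<in> C m" for i x
    using that IH(1) by (intro S.inv_equality[symmetric]) (simp_all flip: IH(4) add: one)
  have inv': "inv\<^bsub>L m\<^esub> g \<otimes>\<^bsub>L m\<^esub> \<alpha> m (- i) x = \<alpha> m (- i) (inv\<^bsub>L m\<^esub> (\<alpha> m i g) \<otimes>\<^bsub>L m\<^esub> x)"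
    if "g \<in> C m" "x \<in> C m" for i g x
    using that IH(1) by (simp add: IH(4) inv flip: IH(3)) (simp add: IH(2))
  show ?case
    unfolding L_Suc[OF Suc.hyps]
  proof (intro conjI allI ballI)
    fix i k x assume x: "x \<in> carrier S.Q"
    then show "\<alpha> (Suc m) i x \<in> carrier S.Q" "\<alpha> (Suc m) 0 x = x"
      using IH by (auto elim!: S.Q_cases simp: mk intro!: S.mk_cong_eq)
    from x show "\<alpha> (Suc m) (i + k) x = \<alpha> (Suc m) i (\<alpha> (Suc m) k x)"
      using IH(1) by (auto elim!: S.Q_cases simp: mk minus_diff_commute simp flip: IH(3) intro!: S.mk_cong_eq)
    fix y assume y: "y \<in> carrier S.Q"
    from x y show "\<alpha> (Suc m) i (x \<otimes>\<^bsub>S.Q\<^esub> y) = \<alpha> (Suc m) i x \<otimes>\<^bsub>S.Q\<^esub> \<alpha> (Suc m) i y"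
      using IH(1) by (auto elim!: S.Q_cases simp: mk IH(4) inv' intro!: S.mk_cong_eq)
    from x y show "\<alpha> (Suc m) i (x \<oplus>\<^bsub>S.Q\<^esub> y) = \<alpha> (Suc m) i x \<oplus>\<^bsub>S.Q\<^esub> \<alpha> (Suc m) i y"
      using IH(1) by (auto elim!: S.Q_cases simp: mk IH(5) intro!: S.mk_cong_eq)
  qed
qed

lemmas act_closed = act_facts[THEN conjunct1, rule_format]
  and act_0 = act_facts[THEN conjunct2, THEN conjunct1, rule_format]
  and act_plus = act_facts[THEN conjunct2, THEN conjunct2, THEN conjunct1, rule_format]
  and act_mult = act_facts[THEN conjunct2, THEN conjunct2, THEN conjunct2, THEN conjunct1, rule_format]
  and act_add = act_facts[THEN conjunct2, THEN conjunct2, THEN conjunct2, THEN conjunct2, rule_format]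

lemma act_mk:
  assumes "1 \<le> m" "m < n" "g \<in> C m"
  shows "\<alpha> (Suc m) i (wreath_step.mk (L m) (p (Suc m)) h g) =
    wreath_step.mk (L m) (p (Suc m)) (\<lambda>x. h (\<alpha> m (- i) x)) (\<alpha> m i g)"
  using assms by (intro act_mk_of_action) (auto simp: act_closed act_0 act_plus)

lemma act_bij:
  assumes "1 \<le> m" "m \<le> n"
  shows "bij_betw (\<alpha> m i) (C m) (C m)"
  using assms
  by (intro bij_betw_byWitness[of _ "\<alpha> m (- i)"]) (auto simp: act_closed act_0 simp flip: act_plus)

lemma act_one:
  assumes "1 \<le> m" "m \<le> n"
  shows "\<alpha> m i \<one>\<^bsub>L m\<^esub> = \<one>\<^bsub>L m\<^esub>"
proof -
  interpret left_brace "L m" using levels[OF assms] by blast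
  show ?thesis
    using act_mult[OF assms, of "\<one>\<^bsub>L m\<^esub>" "\<one>\<^bsub>L m\<^esub>" i] act_closed[OF assms, of "\<one>\<^bsub>L m\<^esub>" i]
    by (simp add: r_cancel_one')
qed

text \<open>
  All levels of the action are built from the first, so they depend on \<open>i\<close> only through \<open>\<gamma>^i\<close>.
\<close>

lemma act_cong:
  assumes "1 \<le> m" "int N dvd (k - i)"
  shows "\<alpha> m i = \<alpha> m k"
  using assms(1)
proof (induction m rule: nat_induct_at_least)
  case base
  show ?case using assms(2) power_\<gamma>_facts(5)[of i k] by (simp add: fun_eq_iff act_1)
next
  case (Suc m)
  then show ?case by (intro ext) (simp add: act_Suc)
qed

lemma act_moves:
  assumes "1 \<le> m" "m \<le> n" "\<not> int N dvd i"
  shows "\<exists>x\<in>C m. \<alpha> m i x \<noteq> x"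
  using assms(1,2)
proof (induction m rule: nat_induct_at_least)
  case base
  have "p 1 > 1" using n_ge_2 by (auto intro!: p_gt_1)
  moreover have "power_\<gamma> i \<noteq> 1"
    using assms(3) power_\<gamma>_facts(5)[of i 0] power_\<gamma>_facts(3) by simp
  ultimately show ?case
    using power_\<gamma>_facts(1,2)[of i]
    by (intro bexI[of _ 1]) (auto simp: act_1 L_1_simps)
next
  case (Suc m)
  interpret S: wreath_step "L m" "p (Suc m)" using Suc by (intro step) auto
  obtain x where "x \<in> C m" "\<alpha> m i x \<noteq> x" using Suc by auto
  then have "\<alpha> (Suc m) i (S.mk (\<lambda>_. 0) x) \<noteq> S.mk (\<lambda>_. 0) x"
    using Suc by (simp add: act_mk act_closed S.mk_eq_iff)
  then show ?case
    using \<open>x \<in> C m\<close> by (auto simp: L_Suc[OF Suc.hyps])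
qed

text \<open>
  On the first level the displacement of \<open>z\<close> is \<open>(1 - \<gamma>^i) z\<close>, and \<open>1 - \<gamma>^i\<close> is invertible.  Above it, the
  section of the projection to the level below is equivariant, so \<open>M\<close> contains the copy of
  that level by induction, and \<open>normal_section_imp_all\<close> applies.
\<close>

lemma normal_displacements_imp_all:
  assumes "1 \<le> m" "m \<le> n" "\<not> int N dvd i" "M \<lhd> L m"
    and "\<And>x. x \<in> C m \<Longrightarrow> x \<otimes>\<^bsub>L m\<^esub> inv\<^bsub>L m\<^esub> (\<alpha> m i x) \<in> M"
  shows "M = C m"
  using assms(1,2,4,5)
proof (induction m arbitrary: M rule: nat_induct_at_least)
  case base
  interpret left_brace "L 1" by (rule left_brace_L_1)
  let ?q = "int (p 1)"
  have q: "?q > 1" using n_ge_2 p_gt_1[of 1] by auto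
  have inv: "inv\<^bsub>L 1\<^esub> x = (- x) mod ?q" if "x \<in> C 1" for x
    using that q by (intro inv_equality) (auto simp: L_1_simps mod_simps)
  have w: "power_\<gamma> i \<noteq> 1"
    using assms(3) power_\<gamma>_facts(5)[of i 0] power_\<gamma>_facts(3) by simp
  have "\<not> ?q dvd 1 - power_\<gamma> i"
  proof
    assume "?q dvd 1 - power_\<gamma> i"
    then have "[1 = power_\<gamma> i] (mod ?q)" by (simp add: cong_iff_dvd_diff)
    then show False using q w power_\<gamma>_facts(1,2)[of i] by (simp add: cong_def)
  qed
  moreover have "Factorial_Ring.prime ?q" using n_ge_2 prime_p[of 1] by simp
  ultimately have "coprime (1 - power_\<gamma> i) ?q"
    by (simp add: coprime_commute prime_imp_coprime)
  then obtain u where u: "[(1 - power_\<gamma> i) * u = 1] (mod ?q)"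
    using cong_solve_coprime_int by blast
  have "y \<in> M" if y: "y \<in> C 1" for y
  proof -
    let ?x = "(u * y) mod ?q"
    have x: "?x \<in> C 1" using q by (simp add: L_1_simps)
    have "?x \<otimes>\<^bsub>L 1\<^esub> inv\<^bsub>L 1\<^esub> (\<alpha> 1 i ?x) = ((1 - power_\<gamma> i) * u * y) mod ?q"
    proof -
      have "\<alpha> 1 i ?x \<in> C 1" using q by (simp add: act_1 L_1_simps)
      then have "?x \<otimes>\<^bsub>L 1\<^esub> inv\<^bsub>L 1\<^esub> (\<alpha> 1 i ?x) = (?x + (- \<alpha> 1 i ?x) mod ?q) mod ?q"
        by (simp only: inv L_1_simps)
      also have "\<dots> = (u * y - power_\<gamma> i * (u * y)) mod ?q"
        unfolding act_1 by (simp add: mod_simps)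
      finally show ?thesis by (simp add: algebra_simps)
    qed
    also have "\<dots> = (1 * y) mod ?q"
      using cong_mult[OF u cong_refl[of y]] by (simp add: cong_def)
    also have "\<dots> = y" using y by (simp add: L_1_simps)
    finally show ?thesis using base(3)[OF x] by simp
  qed
  then show ?case
    using subgroup.subset[OF normal_imp_subgroup[OF base(2)]] by auto
next
  case (Suc m)
  interpret S: wreath_step "L m" "p (Suc m)" using Suc by (intro step) auto
  interpret Q: left_brace S.Q by (rule S.left_brace_Q)
  note LS = L_Suc[OF Suc.hyps]
  let ?s = "\<lambda>g. S.mk (\<lambda>_. 0) g"
  interpret h: group_hom "L m" S.Q ?s
    using S.section_hom by unfold_locales
  have M: "M \<lhd> S.Q" using Suc.prems(2) by (simp add: LS)
  have sub: "subgroup M S.Q" using M by (rule normal_imp_subgroup)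
  have "{g \<in> C m. ?s g \<in> M} = C m"
  proof (rule Suc.IH)
    show "{g \<in> C m. ?s g \<in> M} \<lhd> L m"
      unfolding S.normal_inv_iff
    proof (intro conjI ballI)
      show "subgroup {g \<in> C m. ?s g \<in> M} (L m)"
        using subgroup.one_closed[OF sub] subgroup.m_closed[OF sub] subgroup.m_inv_closed[OF sub]
        by unfold_locales (auto simp del: S.mk_mult simp: h.hom_mult h.hom_inv h.hom_one)
      fix x g assume "x \<in> C m" "g \<in> {g \<in> C m. ?s g \<in> M}"
      moreover from this have "?s x \<otimes>\<^bsub>S.Q\<^esub> ?s g \<otimes>\<^bsub>S.Q\<^esub> inv\<^bsub>S.Q\<^esub> ?s x \<in> M"
        by (intro normal.inv_op_closed2[OF M]) auto
      ultimately show "x \<otimes>\<^bsub>L m\<^esub> g \<otimes>\<^bsub>L m\<^esub> inv\<^bsub>L m\<^esub> x \<in> {g \<in> C m. ?s g \<in> M}"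
        by (simp add: h.hom_mult h.hom_inv del: S.mk_mult)
    qed
    fix x assume x: "x \<in> C m"
    have "?s x \<otimes>\<^bsub>S.Q\<^esub> inv\<^bsub>S.Q\<^esub> (\<alpha> (Suc m) i (?s x)) \<in> M"
      using Suc.prems(3)[of "?s x"] x by (simp only: LS S.mk_closed)
    moreover have "\<alpha> (Suc m) i (?s x) = ?s (\<alpha> m i x)"
      using Suc x by (simp add: act_mk)
    ultimately show "x \<otimes>\<^bsub>L m\<^esub> inv\<^bsub>L m\<^esub> (\<alpha> m i x) \<in> {g \<in> C m. ?s g \<in> M}"
      using x Suc by (simp add: h.hom_mult h.hom_inv act_closed del: S.mk_mult)
  qed (use Suc in auto)
  then have "\<And>g. g \<in> C m \<Longrightarrow> ?s g \<in> M" by auto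
  then show ?case unfolding LS by (intro S.normal_section_imp_all M)
qed

lemma derived_L:
  assumes "1 \<le> m" "m \<le> n"
  shows "(derived (L m) ^^ m) (C m) = {\<one>\<^bsub>L m\<^esub>} \<and> (derived (L m) ^^ (m - 1)) (C m) \<noteq> {\<one>\<^bsub>L m\<^esub>}"
  using assms
proof (induction m rule: nat_induct_at_least)
  case base
  interpret left_brace "L 1" by (rule left_brace_L_1)
  interpret comm_group "L 1"
    by unfold_locales (auto simp: L_1_simps add.commute)
  have "derived (L 1) (C 1) = {\<one>\<^bsub>L 1\<^esub>}" by (rule derived_eq_singleton) simp
  moreover have "C 1 \<noteq> {\<one>\<^bsub>L 1\<^esub>}"
    using levels[of 1] n_ge_2 by auto
  ultimately show ?case by (simp add: One_nat_def)
next
  case (Suc m)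
  interpret S: wreath_step "L m" "p (Suc m)" using Suc by (intro step) auto
  have "Suc m - 1 = Suc (m - 1)" using Suc.hyps by simp
  then show ?case
    using Suc S.derived_Q_trivial[of m] S.derived_Q_nontrivial[of "m - 1"] by (simp only: L_Suc) auto
qed

end


context simple_tower
begin

section \<open>The form on the tower and the cyclic group A\<close>

text \<open>
  The component \<open>b'\<^sub>j\<close> of the form, evaluated on a level \<open>m \<ge> j\<close>; the induction on \<open>m\<close> needs it below
  the top level.
\<close>

definition form :: "nat \<Rightarrow> nat \<Rightarrow> int \<Rightarrow> int \<Rightarrow> int" where
  "form m j x y = bform_quot (L (j - 1)) (Fp (p j)) (hcoord p m j x) (hcoord p m j y)"

lemma form_mk:
  assumes "1 \<le> m" "m < n" "g \<in> C m" "g' \<in> C m"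
  shows "form (Suc m) j (wreath_step.mk (L m) (p (Suc m)) h g) (wreath_step.mk (L m) (p (Suc m)) h' g') =
    (if j = Suc m then wreath_step.fun_form (L m) h h' mod int (p (Suc m)) else form m j g g')"
proof -
  interpret S: wreath_step "L m" "p (Suc m)" using assms by (intro step) auto
  show ?thesis
    using assms by (simp add: form_def level_Suc S.bform_quot_fcoset)
qed

lemma form_facts:
  assumes "1 \<le> m" "m \<le> n" "j \<in> {2..m}" "x \<in> C m" "y \<in> C m" "z \<in> C m"
  shows "form m j x y \<in> {0..<int (p j)} \<and> form m j x y = form m j y x \<and>
    form m j (x \<oplus>\<^bsub>L m\<^esub> y) z = (form m j x z + form m j y z) mod int (p j) \<and>
    form m j (lambda_map (L m) z x) (lambda_map (L m) z y) = form m j x y \<and>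
    form m j (\<alpha> m i x) (\<alpha> m i y) = form m j x y"
  using assms
proof (induction m arbitrary: x y z rule: nat_induct_at_least)
  case (Suc m)
  interpret S: wreath_step "L m" "p (Suc m)" using Suc by (intro step) auto
  interpret Q: left_brace S.Q by (rule S.left_brace_Q)
  note LS = L_Suc[OF Suc.hyps]
  obtain h g where x: "x = S.mk h g" and g: "g \<in> C m" using Suc.prems(3) unfolding LS by auto
  obtain h' g' where y: "y = S.mk h' g'" and g': "g' \<in> C m" using Suc.prems(4) unfolding LS by auto
  obtain k l where z: "z = S.mk k l" and l: "l \<in> C m" using Suc.prems(5) unfolding LS by auto
  have m: "1 \<le> m" "m < n" "m \<le> n" using Suc by auto
  have lam: "lambda_map (L (Suc m)) (S.mk k l) (S.mk f e) = S.mk (\<lambda>x. f (inv\<^bsub>L m\<^esub> l \<otimes>\<^bsub>L m\<^esub> x)) (lambda_map (L m) l e)"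
    if "e \<in> C m" for f e
    using S.lambda_mk[OF l that] by (simp only: LS)
  have bij: "bij_betw (\<lambda>x. inv\<^bsub>L m\<^esub> l \<otimes>\<^bsub>L m\<^esub> x) (C m) (C m)"
    by (rule bij_betw_byWitness[of _ "\<lambda>x. l \<otimes>\<^bsub>L m\<^esub> x"])
      (use l in \<open>auto simp: S.m_assoc[symmetric]\<close>)
  show ?case
  proof (cases "j = Suc m")
    case True
    have "S.fun_form (\<lambda>x. h (inv\<^bsub>L m\<^esub> l \<otimes>\<^bsub>L m\<^esub> x)) (\<lambda>x. h' (inv\<^bsub>L m\<^esub> l \<otimes>\<^bsub>L m\<^esub> x)) = S.fun_form h h'"
      by (rule S.fun_form_reindex[OF bij])
    moreover have "S.fun_form (\<lambda>x. h (\<alpha> m (- i) x)) (\<lambda>x. h' (\<alpha> m (- i) x)) = S.fun_form h h'"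
      by (rule S.fun_form_reindex[OF act_bij[OF m(1,3)]])
    ultimately show ?thesis
      using True m g g' l S.q_gt_1 unfolding x y z
      by (simp add: form_mk act_mk act_closed lam S.fun_form_add_left S.fun_form_commute[of h h'] mod_simps)
        (simp add: LS form_mk S.fun_form_add_left mod_simps)
  next
    case False
    then have "j \<in> {2..m}" using Suc.prems by auto
    from Suc.IH[OF m(3) this g g' l] show ?thesis
      using False m g g' l unfolding x y z
      by (simp add: form_mk act_mk act_closed lam) (simp add: LS form_mk)
  qed
qed auto

lemmas form_range = form_facts[THEN conjunct1]
  and form_sym = form_facts[THEN conjunct2, THEN conjunct1]
  and form_add = form_facts[THEN conjunct2, THEN conjunct2, THEN conjunct1]
  and form_lambda = form_facts[THEN conjunct2, THEN conjunct2, THEN conjunct2, THEN conjunct1]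
  and form_act = form_facts[THEN conjunct2, THEN conjunct2, THEN conjunct2, THEN conjunct2]

text \<open>
  In each level a nonconstant function is paired with one that it does not annihilate, on top of
  the pair chosen below.
\<close>

lemma form_generic:
  assumes "1 \<le> m" "m \<le> n"
  shows "\<exists>x\<in>C m. \<exists>y\<in>C m. \<forall>j\<in>{2..m}. form m j x y \<noteq> 0"
  using assms
proof (induction m rule: nat_induct_at_least)
  case base
  have "\<one>\<^bsub>L 1\<^esub> \<in> C 1" using n_ge_2 p_gt_1[of 1] by (simp add: L_1_simps)
  then show ?case by auto
next
  case (Suc m)
  interpret S: wreath_step "L m" "p (Suc m)" using Suc by (intro step) auto
  obtain x y where xy: "x \<in> C m" "y \<in> C m" "\<forall>j\<in>{2..m}. form m j x y \<noteq> 0" using Suc by auto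
  obtain k where k: "k \<in> C m" "k \<noteq> \<one>\<^bsub>L m\<^esub>"
  proof -
    have "C m \<noteq> {\<one>\<^bsub>L m\<^esub>}" using S.card_gt_2 by auto
    then show ?thesis using that S.one_closed by blast
  qed
  have "inj_on ((\<otimes>\<^bsub>L m\<^esub>) k) (C m)" using k by (auto simp: inj_on_def)
  from S.moved_fun_nonconst[OF this S.one_closed] k obtain h :: "int \<Rightarrow> int"
    where "\<not> (\<exists>c. \<forall>x\<in>C m. [h x - h (k \<otimes>\<^bsub>L m\<^esub> x) = c] (mod int (p (Suc m))))" by auto
  then obtain h' where "S.fun_form (\<lambda>x. h x - h (k \<otimes>\<^bsub>L m\<^esub> x)) h' mod int (p (Suc m)) \<noteq> 0"
    by (rule S.fun_form_nondegenerate)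
  then have "\<forall>j\<in>{2..Suc m}. form (Suc m) j (S.mk (\<lambda>x. h x - h (k \<otimes>\<^bsub>L m\<^esub> x)) x) (S.mk h' y) \<noteq> 0"
    using xy Suc by (auto simp: form_mk)
  moreover have "S.mk (\<lambda>x. h x - h (k \<otimes>\<^bsub>L m\<^esub> x)) x \<in> C (Suc m)" "S.mk h' y \<in> C (Suc m)"
    using xy by (simp_all add: L_Suc[OF Suc.hyps])
  ultimately show ?case by blast
qed

abbreviation "A \<equiv> Abrace p n"

lemma A_simps:
  "carrier A = (\<Pi>\<^sub>E j\<in>{2..n}. {0..<int (p j)})"
  "c \<oplus>\<^bsub>A\<^esub> d = (\<lambda>j\<in>{2..n}. (c j + d j) mod int (p j))"
  "\<zero>\<^bsub>A\<^esub> = (\<lambda>j\<in>{2..n}. 0)"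
  by (simp_all add: Abrace_def trivial_brace_def Fp_simps)

lemma pos_p: "j \<in> {2..n} \<Longrightarrow> int (p j) > 1"
  using p_gt_1[of j] by auto

lemma A_eqI: "c \<in> carrier A \<Longrightarrow> d \<in> carrier A \<Longrightarrow> (\<And>j. j \<in> {2..n} \<Longrightarrow> c j = d j) \<Longrightarrow> c = d"
  unfolding A_simps by (rule PiE_ext)

lemma residues_in_A [simp]: "(\<lambda>j\<in>{2..n}. f j mod int (p j)) \<in> carrier A"
  using pos_p by (force simp: A_simps)

lemma abelian_group_A: "abelian_group A"
proof (rule abelian_groupI)
  show "\<zero>\<^bsub>A\<^esub> \<in> carrier A" using pos_p by (force simp: A_simps)
  show "c \<oplus>\<^bsub>A\<^esub> d \<in> carrier A" for c d by (simp add: A_simps(2))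
  show "c \<oplus>\<^bsub>A\<^esub> d \<oplus>\<^bsub>A\<^esub> e = c \<oplus>\<^bsub>A\<^esub> (d \<oplus>\<^bsub>A\<^esub> e)" for c d e
    by (simp add: A_simps(2) mod_simps add.assoc cong: restrict_cong)
  show "c \<oplus>\<^bsub>A\<^esub> d = d \<oplus>\<^bsub>A\<^esub> c" for c d
    by (simp add: A_simps(2) add.commute)
  fix c assume c: "c \<in> carrier A"
  then show "\<zero>\<^bsub>A\<^esub> \<oplus>\<^bsub>A\<^esub> c = c"
    by (intro A_eqI) (auto simp: A_simps(2,3), auto simp: A_simps(1) PiE_def Pi_def)
  show "\<exists>d\<in>carrier A. d \<oplus>\<^bsub>A\<^esub> c = \<zero>\<^bsub>A\<^esub>"
    by (intro bexI[of _ "\<lambda>j\<in>{2..n}. (- c j) mod int (p j)"] residues_in_A)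
      (simp add: A_simps(2,3) mod_simps cong: restrict_cong)
qed

lemma A_pow:
  assumes "c \<in> carrier A"
  shows "c [^]\<^bsub>add_monoid A\<^esub> (i :: int) = (\<lambda>j\<in>{2..n}. (i * c j) mod int (p j))"
proof -
  interpret A: abelian_group A by (rule abelian_group_A)
  have nat: "c [^]\<^bsub>add_monoid A\<^esub> (k :: nat) = (\<lambda>j\<in>{2..n}. (int k * c j) mod int (p j))" for k
  proof (induction k)
    case (Suc k)
    have "c [^]\<^bsub>add_monoid A\<^esub> Suc k = (\<lambda>j\<in>{2..n}. (int k * c j) mod int (p j)) \<oplus>\<^bsub>A\<^esub> c"
      unfolding nat_pow_Suc Suc.IH by simp
    also have "\<dots> = (\<lambda>j\<in>{2..n}. (int (Suc k) * c j) mod int (p j))"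
      unfolding A_simps(2) by (rule restrict_ext) (simp add: mod_simps algebra_simps)
    finally show ?case .
  qed (simp add: A_simps(3))
  show ?thesis
  proof (cases i rule: int_cases2)
    case (nonneg k)
    show ?thesis unfolding nonneg int_pow_int nat ..
  next
    case (nonpos k)
    have "inv\<^bsub>add_monoid A\<^esub> (\<lambda>j\<in>{2..n}. (int k * c j) mod int (p j)) = (\<lambda>j\<in>{2..n}. (- int k * c j) mod int (p j))"
      by (rule group.inv_equality[OF A.a_group]) (simp_all, simp add: A_simps(2,3) mod_simps cong: restrict_cong)
    moreover have "c \<in> carrier (add_monoid A)" using assms by simp
    ultimately show ?thesis unfolding nonpos by (simp only: group.int_pow_neg_int[OF A.a_group] nat)
  qed
qed

lemma coprime_p:
  assumes "i \<in> {2..n}" "j \<in> {2..n}" "i \<noteq> j"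
  shows "coprime (p i) (p j)"
  using assms prime_p inj_p by (intro primes_coprime) (auto dest: inj_onD)

lemma N_dvd_iff: "int N dvd k \<longleftrightarrow> (\<forall>j\<in>{2..n}. int (p j) dvd k)"
proof
  assume "int N dvd k"
  moreover have "int (p j) dvd int N" if "j \<in> {2..n}" for j
    unfolding int_dvd_int_iff using that by (intro dvd_prodI) auto
  ultimately show "\<forall>j\<in>{2..n}. int (p j) dvd k" using dvd_trans by blast
next
  assume *: "\<forall>j\<in>{2..n}. int (p j) dvd k"
  have "[nat \<bar>k\<bar> = 0] (mod N)"
    using * coprime_p by (intro coprime_cong_prod_nat) (auto simp: cong_0_iff dvd_nat_abs_iff)
  then show "int N dvd k" by (simp only: cong_0_iff dvd_nat_abs_iff)
qed

lemma simultaneous_congruences: "\<exists>i::int. \<forall>j\<in>{2..n}. [i = u j] (mod int (p j))"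
proof -
  obtain i where i: "\<forall>j\<in>{2..n}. [i = nat (u j mod int (p j))] (mod p j)"
    using chinese_remainder_nat[of "{2..n}" p "\<lambda>j. nat (u j mod int (p j))"] coprime_p by auto
  have "[int i = u j] (mod int (p j))" if j: "j \<in> {2..n}" for j
  proof -
    have "[int i = int (nat (u j mod int (p j)))] (mod int (p j))"
      using bspec[OF i j] by (rule cong_int_iff[THEN iffD2])
    moreover have "int (nat (u j mod int (p j))) = u j mod int (p j)"
      using pos_p[OF j] by simp
    ultimately show ?thesis by (simp add: cong_def)
  qed
  then show ?thesis by blast
qed

text \<open>
  An element with no vanishing component generates the cyclic group \<open>A\<close>, by the Chinese remainder
  theorem.  This is used both for the distinguished generator, to make \<^const>\<open>actA\<close> meaningful, and
  for a value of the form.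
\<close>

lemma A_generated:
  assumes c: "c \<in> carrier A" "\<And>j. j \<in> {2..n} \<Longrightarrow> c j \<noteq> 0" and d: "d \<in> carrier A"
  shows "\<exists>i::int. c [^]\<^bsub>add_monoid A\<^esub> i = d"
proof -
  have "\<exists>v. [c j * v = 1] (mod int (p j))" if j: "j \<in> {2..n}" for j
  proof -
    have "0 < c j" "c j < int (p j)" using c(1) c(2)[OF j] j by (force simp: A_simps PiE_def Pi_def)+
    then have "\<not> int (p j) dvd c j" using zdvd_not_zless by blast
    moreover have "Factorial_Ring.prime (int (p j))" using j prime_p by simp
    ultimately have "coprime (int (p j)) (c j)" by (intro prime_imp_coprime)
    then have "coprime (c j) (int (p j))" by (rule coprime_commute[THEN iffD1])
    then show ?thesis by (rule cong_solve_coprime_int)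
  qed
  then obtain v where v: "\<And>j. j \<in> {2..n} \<Longrightarrow> [c j * v j = 1] (mod int (p j))" by metis
  obtain i :: int where i: "\<And>j. j \<in> {2..n} \<Longrightarrow> [i = d j * v j] (mod int (p j))"
    using simultaneous_congruences[of "\<lambda>j. d j * v j"] by blast
  have "c [^]\<^bsub>add_monoid A\<^esub> i = d"
    unfolding A_pow[OF c(1)]
  proof (rule A_eqI)
    fix j assume j: "j \<in> {2..n}"
    have "[i * c j = d j * v j * c j] (mod int (p j))" using i[OF j] by (intro cong_mult) auto
    also have "d j * v j * c j = d j * (c j * v j)" by simp
    also have "[d j * (c j * v j) = d j * 1] (mod int (p j))" using v[OF j] by (intro cong_mult) auto
    finally have "(i * c j) mod int (p j) = d j mod int (p j)" by (simp add: cong_def)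
    also have "\<dots> = d j" using d j by (auto simp: A_simps PiE_def Pi_def)
    finally show "(\<lambda>j\<in>{2..n}. (i * c j) mod int (p j)) j = d j" using j by simp
  qed (use d in auto)
  then show ?thesis ..
qed

lemma Agen_closed: "Agen n \<in> carrier A"
  using pos_p by (force simp: A_simps Agen_def)

definition index :: "(nat \<Rightarrow> int) \<Rightarrow> int" where
  "index c = (SOME i::int. [i] \<cdot>\<^bsub>A\<^esub> Agen n = c)"

lemma actA_eq: "actA p \<gamma> n c = \<alpha> n (index c)"
  by (simp add: actA_def index_def)

lemma index_mod:
  assumes "c \<in> carrier A" "j \<in> {2..n}"
  shows "index c mod int (p j) = c j"
proof -
  have "\<exists>i::int. [i] \<cdot>\<^bsub>A\<^esub> Agen n = c"
    using A_generated[OF Agen_closed _ assms(1)] by (simp add: Agen_def add_pow_def)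
  then have "[index c] \<cdot>\<^bsub>A\<^esub> Agen n = c" unfolding index_def by (rule someI_ex)
  then have "(\<lambda>j\<in>{2..n}. (index c * Agen n j) mod int (p j)) = c"
    unfolding add_pow_def A_pow[OF Agen_closed] .
  then show ?thesis using assms(2) by (auto simp: Agen_def dest: fun_cong[of _ _ j])
qed

lemma index_add:
  assumes "c \<in> carrier A" "d \<in> carrier A"
  shows "int N dvd index (c \<oplus>\<^bsub>A\<^esub> d) - (index c + index d)"
  unfolding N_dvd_iff
proof
  fix j assume j: "j \<in> {2..n}"
  have "c \<oplus>\<^bsub>A\<^esub> d \<in> carrier A" by (simp add: A_simps(2))
  then have "index (c \<oplus>\<^bsub>A\<^esub> d) mod int (p j) = (index c mod int (p j) + index d mod int (p j)) mod int (p j)"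
    using assms j by (simp add: index_mod A_simps(2))
  then show "int (p j) dvd index (c \<oplus>\<^bsub>A\<^esub> d) - (index c + index d)"
    by (simp add: mod_simps mod_eq_dvd_iff)
qed

lemma N_dvd_index_iff: "c \<in> carrier A \<Longrightarrow> int N dvd index c \<longleftrightarrow> c = \<zero>\<^bsub>A\<^esub>"
proof -
  assume c: "c \<in> carrier A"
  have zero: "\<zero>\<^bsub>A\<^esub> \<in> carrier A"
    by (rule abelian_monoid.zero_closed[OF abelian_group.axioms(1)[OF abelian_group_A]])
  have "int N dvd index c \<longleftrightarrow> (\<forall>j\<in>{2..n}. index c mod int (p j) = 0)"
    unfolding N_dvd_iff by (simp only: dvd_eq_mod_eq_0)
  also have "\<dots> \<longleftrightarrow> (\<forall>j\<in>{2..n}. c j = \<zero>\<^bsub>A\<^esub> j)"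
    using index_mod[OF c] by (simp add: A_simps(3))
  also have "\<dots> \<longleftrightarrow> c = \<zero>\<^bsub>A\<^esub>"
    using A_eqI[OF c zero] by blast
  finally show ?thesis .
qed

section \<open>Simplicity and derived length\<close>

lemma bil_eq: "bil p n x y = (\<lambda>j\<in>{2..n}. form n j x y)"
  by (simp add: bil_def form_def)

sublocale AP: asym_product "L n" A "bil p n" "actA p \<gamma> n"
proof -
  have n: "1 \<le> n" "n \<le> n" using n_ge_2 by auto
  interpret G: left_brace "L n" using levels[OF n] by blast
  interpret A: abelian_group A by (rule abelian_group_A)
  show "asym_product (L n) A (bil p n) (actA p \<gamma> n)"
  proof
    fix x y z assume x: "x \<in> C n" and y: "y \<in> C n"
    show "bil p n x y \<in> carrier A"
      unfolding bil_eq A_simps(1) using form_range[OF n _ x y x] by (intro restrict_PiE_iff[THEN iffD2] ballI)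
    show "bil p n x y = bil p n y x"
      unfolding bil_eq by (rule restrict_ext) (rule form_sym[OF n _ x y x])
    show "bil p n (lambda_map (L n) z x) (lambda_map (L n) z y) = bil p n x y" if "z \<in> C n"
      unfolding bil_eq by (rule restrict_ext) (rule form_lambda[OF n _ x y that])
    show "bil p n (x \<oplus>\<^bsub>L n\<^esub> y) z = bil p n x z \<oplus>\<^bsub>A\<^esub> bil p n y z" if "z \<in> C n"
      unfolding bil_eq A_simps(2) using form_add[OF n _ x y that] by (intro restrict_ext) simp
    show "actA p \<gamma> n \<zero>\<^bsub>A\<^esub> x = x"
      using act_cong[OF n(1), of "index \<zero>\<^bsub>A\<^esub>" 0] N_dvd_index_iff[OF A.zero_closed] act_0[OF n x]
      by (simp add: actA_eq)
    fix c assume c: "c \<in> carrier A"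
    show "bil p n (actA p \<gamma> n c x) (actA p \<gamma> n c y) = bil p n x y"
      unfolding bil_eq actA_eq by (rule restrict_ext) (rule form_act[OF n _ x y x])
    show "actA p \<gamma> n c x \<in> C n" "actA p \<gamma> n c (x \<otimes>\<^bsub>L n\<^esub> y) = actA p \<gamma> n c x \<otimes>\<^bsub>L n\<^esub> actA p \<gamma> n c y"
      "actA p \<gamma> n c (x \<oplus>\<^bsub>L n\<^esub> y) = actA p \<gamma> n c x \<oplus>\<^bsub>L n\<^esub> actA p \<gamma> n c y"
      using x y by (simp_all add: actA_eq act_closed[OF n] act_mult[OF n] act_add[OF n])
    show "actA p \<gamma> n (c \<oplus>\<^bsub>A\<^esub> d) x = actA p \<gamma> n c (actA p \<gamma> n d x)" if "d \<in> carrier A" for d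
      using fun_cong[OF act_cong[OF n(1) index_add[OF c that]], of x]
        act_plus[OF n x, of "index c" "index d"] by (simp add: actA_eq)
  qed
qed

text \<open>
  Conjugating \<open>g = (f, e)\<close> with a function \<open>h\<close> of the top level adds \<open>h - h \<circ> \<sigma>\<close>, where \<open>\<sigma>\<close> is the permutation
  of the level below by which \<open>(e, c)\<close> acts (inverted).  If \<open>\<sigma>\<close> is not the identity then a suitable
  \<open>h\<close> makes this nonconstant; otherwise \<open>e\<close> and \<open>c\<close> vanish and \<open>g\<close> itself is a nonconstant function.
  Nonconstant functions are detected by the nondegenerate form, and \<open>\<lambda>\<close> of a top-level function fixes
  all top-level functions.
\<close>

lemma nonzero_element_meets_form:
  assumes g: "g \<in> C n" and c: "c \<in> carrier A" and gc: "(g, c) \<noteq> (\<one>\<^bsub>L n\<^esub>, \<zero>\<^bsub>A\<^esub>)"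
  shows "\<exists>u\<in>C n. \<exists>x\<in>C n. lambda_map (L n) x u = u \<and> bil p n u x \<noteq> \<zero>\<^bsub>A\<^esub> \<and>
    (u = g \<or> (\<exists>h\<in>C n. h \<otimes>\<^bsub>L n\<^esub> g \<otimes>\<^bsub>L n\<^esub> actA p \<gamma> n c (inv\<^bsub>L n\<^esub> h) = u \<oplus>\<^bsub>L n\<^esub> g))"
proof -
  obtain m where n_eq: "n = Suc m" and m: "1 \<le> m" "m < n" "m \<le> n"
    using n_ge_2 by (cases n) auto
  interpret S: wreath_step "L m" "p (Suc m)" using m by (intro step) auto
  have Ln: "L n = S.Q" unfolding n_eq by (rule L_Suc[OF m(1)])
  let ?i = "index c"
  obtain f e where f: "g = S.mk f e" and e: "e \<in> C m" using g unfolding Ln by auto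
  have act_S: "\<alpha> n i (S.mk h x) = S.mk (\<lambda>x. h (\<alpha> m (- i) x)) (\<alpha> m i x)" if "x \<in> C m" for i h x
    using act_mk[OF m(1,2) that] unfolding n_eq .
  have nonconst: "\<exists>x\<in>C n. lambda_map (L n) x (S.mk k \<one>\<^bsub>L m\<^esub>) = S.mk k \<one>\<^bsub>L m\<^esub> \<and> bil p n (S.mk k \<one>\<^bsub>L m\<^esub>) x \<noteq> \<zero>\<^bsub>A\<^esub>"
    if k: "\<not> (\<exists>c. \<forall>x\<in>C m. [k x = c] (mod int (p (Suc m))))" for k
  proof -
    obtain h where h: "S.fun_form k h mod int (p (Suc m)) \<noteq> 0" using S.fun_form_nondegenerate[OF k] .
    have "bil p n (S.mk k \<one>\<^bsub>L m\<^esub>) (S.mk h \<one>\<^bsub>L m\<^esub>) (Suc m) = S.fun_form k h mod int (p (Suc m))"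
      using m n_ge_2 form_mk[OF m(1,2) S.one_closed S.one_closed, of "Suc m" k h]
      unfolding bil_eq by (simp add: n_eq)
    with h have "bil p n (S.mk k \<one>\<^bsub>L m\<^esub>) (S.mk h \<one>\<^bsub>L m\<^esub>) \<noteq> \<zero>\<^bsub>A\<^esub>"
    proof -
      have "Suc m \<in> {2..n}" using m by (simp add: n_eq)
      then have "\<zero>\<^bsub>A\<^esub> (Suc m) = 0" unfolding A_simps(3) by simp
      with h show ?thesis
        using \<open>bil p n _ _ (Suc m) = _\<close> by metis
    qed
    moreover have "lambda_map (L n) (S.mk h \<one>\<^bsub>L m\<^esub>) (S.mk k \<one>\<^bsub>L m\<^esub>) = S.mk k \<one>\<^bsub>L m\<^esub>"
      unfolding Ln by (auto simp: S.lambda_mk intro!: S.mk_cong_eq)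
    ultimately show ?thesis by (intro bexI[of _ "S.mk h \<one>\<^bsub>L m\<^esub>"]) (auto simp: Ln)
  qed
  define \<sigma> where "\<sigma> x = \<alpha> m (- ?i) (inv\<^bsub>L m\<^esub> e \<otimes>\<^bsub>L m\<^esub> x)" for x
  show ?thesis
  proof (cases "\<exists>y\<in>C m. \<sigma> y \<noteq> y")
    case True
    then obtain y where y: "y \<in> C m" "\<sigma> y \<noteq> y" by auto
    have "inj_on \<sigma> (C m)"
    proof (rule inj_onI)
      fix x x' assume x: "x \<in> C m" "x' \<in> C m" and eq: "\<sigma> x = \<sigma> x'"
      have "inv\<^bsub>L m\<^esub> e \<otimes>\<^bsub>L m\<^esub> x = inv\<^bsub>L m\<^esub> e \<otimes>\<^bsub>L m\<^esub> x'"
        by (rule inj_onD[OF bij_betw_imp_inj_on[OF act_bij[OF m(1,3)]] eq[unfolded \<sigma>_def]])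
          (use x e in simp_all)
      then show "x = x'" using x e by simp
    qed
    then obtain h :: "int \<Rightarrow> int" where h: "\<not> (\<exists>c. \<forall>x\<in>C m. [h x - h (\<sigma> x) = c] (mod int (p (Suc m))))"
      using S.moved_fun_nonconst[of \<sigma> y] y by blast
    let ?u = "S.mk (\<lambda>x. h x - h (\<sigma> x)) \<one>\<^bsub>L m\<^esub>" and ?h = "S.mk h \<one>\<^bsub>L m\<^esub>"
    have "?h \<otimes>\<^bsub>L n\<^esub> g \<otimes>\<^bsub>L n\<^esub> actA p \<gamma> n c (inv\<^bsub>L n\<^esub> ?h) = ?u \<oplus>\<^bsub>L n\<^esub> g"
      using e act_one[OF m(1,3)] S.l_zero[OF e] act_closed[OF m(1,3)] unfolding f actA_eq Ln
      by (auto simp: S.inv_mk act_S \<sigma>_def S.zero_eq_one intro!: S.mk_cong_eq)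
    moreover have "?u \<in> C n" "?h \<in> C n" by (simp_all add: Ln)
    ultimately show ?thesis using nonconst[OF h] by blast
  next
    case False
    then have \<sigma>: "\<sigma> x = x" if "x \<in> C m" for x using that by auto
    \<comment> \<open>Evaluating the permutation at \<open>e\<close> separates its translation part from the action of \<open>c\<close>.\<close>
    have "\<sigma> e = \<one>\<^bsub>L m\<^esub>" using e act_one[OF m(1,3)] by (simp add: \<sigma>_def)
    then have e1: "e = \<one>\<^bsub>L m\<^esub>" using \<sigma>[OF e] by simp
    have "\<forall>x\<in>C m. \<alpha> m (- ?i) x = x" using \<sigma> by (simp add: \<sigma>_def e1)
    then have "int N dvd - ?i" using act_moves[OF m(1,3), of "- ?i"] by blast
    then have "c = \<zero>\<^bsub>A\<^esub>" using N_dvd_index_iff[OF c] by simp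
    then have "g \<noteq> \<one>\<^bsub>S.Q\<^esub>" using gc by (simp add: Ln)
    then have "\<not> (\<exists>c. \<forall>x\<in>C m. [f x = c] (mod int (p (Suc m))))"
      by (simp add: f e1 S.mk_eq_one_iff)
    from nonconst[OF this] show ?thesis using g unfolding f e1 by blast
  qed
qed

lemma GbarA_eq: "GbarA p \<gamma> n = AP.P"
  by (simp add: GbarA_def)

lemma displacements_generate:
  assumes "c \<in> carrier A" "c \<noteq> \<zero>\<^bsub>A\<^esub>" "M \<lhd> L n"
    and "\<And>x. x \<in> C n \<Longrightarrow> x \<otimes>\<^bsub>L n\<^esub> inv\<^bsub>L n\<^esub> (actA p \<gamma> n c x) \<in> M"
  shows "M = C n"
  using assms n_ge_2 N_dvd_index_iff[OF assms(1)]
  by (intro normal_displacements_imp_all[of n "index c"]) (auto simp: actA_eq)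

lemma Agen_nonzero: "Agen n \<noteq> \<zero>\<^bsub>A\<^esub>"
  using n_ge_2 by (auto simp: A_simps(3) Agen_def fun_eq_iff)

lemma simple_GbarA: "simple_left_brace (GbarA p \<gamma> n)"
  unfolding GbarA_eq
proof (rule AP.simple_P)
  have n: "1 \<le> n" "n \<le> n" using n_ge_2 by auto
  obtain x y where xy: "x \<in> C n" "y \<in> C n" "\<forall>j\<in>{2..n}. form n j x y \<noteq> 0"
    using form_generic[OF n] by auto
  have "S = carrier A" if S: "subgroup S (add_monoid A)" "bil p n x y \<in> S" for S
  proof
    show "carrier A \<subseteq> S"
    proof
      fix d assume "d \<in> carrier A"
      then obtain i :: int where "bil p n x y [^]\<^bsub>add_monoid A\<^esub> i = d"
        using A_generated[of "bil p n x y" d] xy AP.b_closed by (auto simp: bil_eq)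
      then show "d \<in> S"
        using group.subgroup_int_pow_closed[OF abelian_group.a_group[OF abelian_group_A] S, of i] by simp
    qed
  qed (use subgroup.subset[OF S(1)] in auto)
  then show "\<exists>g\<in>C n. \<exists>g'\<in>C n. \<forall>S. subgroup S (add_monoid A) \<longrightarrow> bil p n g g' \<in> S \<longrightarrow> S = carrier A"
    using xy by blast
  show "carrier A \<noteq> {\<zero>\<^bsub>A\<^esub>}" using Agen_closed Agen_nonzero by auto
qed (use nonzero_element_meets_form displacements_generate in blast)+

lemma derived_length_GbarA: "derived_length (GbarA p \<gamma> n) = enat (n + 1)"
proof -
  have n: "1 \<le> n" "n \<le> n" "n = Suc (n - 1)" using n_ge_2 by auto
  have D: "(derived AP.P ^^ Suc d) (carrier AP.P) = (\<lambda>g. (g, \<zero>\<^bsub>A\<^esub>)) ` ((derived (L n) ^^ d) (C n))" for d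
    using displacements_generate[OF Agen_closed Agen_nonzero] Agen_closed by (intro AP.derived_P) auto
  have "derived_length AP.P = enat (Suc n)"
  proof (rule derived_length_eqI[OF AP.group_P])
    show "(derived AP.P ^^ Suc n) (carrier AP.P) = {\<one>\<^bsub>AP.P\<^esub>}"
      unfolding D using derived_L[OF n(1,2)] by simp
    have "(derived AP.P ^^ Suc (n - 1)) (carrier AP.P) \<noteq> {\<one>\<^bsub>AP.P\<^esub>}"
      unfolding D using derived_L[OF n(1,2)] by (auto simp: image_def) 
    then show "(derived AP.P ^^ n) (carrier AP.P) \<noteq> {\<one>\<^bsub>AP.P\<^esub>}"
      using n(3) by simp
  qed
  then show ?thesis by (simp add: GbarA_eq)
qed

end

theorem theorem5p3:
  fixes n :: nat and p :: "nat \<Rightarrow> nat" and \<gamma> :: int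
  assumes "n \<ge> 2"
    and "\<forall>i\<in>{1..n}. Factorial_Ring.prime (p i)"
    and "inj_on p {1..n}"
    and "\<forall>j\<in>{2..n}. \<forall>i\<in>{1..<j}. p j dvd p i - 1"
    and "\<gamma> \<in> carrier (mult_of (Fp (p 1)))"
    and "group.ord (mult_of (Fp (p 1))) \<gamma> = (\<Prod>j\<in>{2..n}. p j)"
  shows "simple_left_brace (GbarA p \<gamma> n) \<and> derived_length (GbarA p \<gamma> n) = enat (n + 1)"
proof -
  interpret simple_tower n p \<gamma>
    using assms by unfold_locales auto
  show ?thesis using simple_GbarA derived_length_GbarA by blast
qed

end
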